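(* Let $G$ be a graph with $\chi(G) < 0$ and let $n$ be a natural number with $n \geq 2 - \chi(G)$. Then there is no continuous map $s_n : \mathrm{Conf}_n(G) \to \mathrm{Conf}_{n+1}(G)$ with $\phi_{n+1} \circ s_n = \mathrm{id}_{\mathrm{Conf}_n(G)}$, where $\phi_{n+1} : \mathrm{Conf}_{n+1}(G) \to \mathrm{Conf}_n(G)$ is the forgetting map $(x_1, \ldots, x_{n+1}) \mapsto (x_1, \ldots, x_n)$. That is, no section $s_n$ exists.
   Context: A graph is a finite connected 1-dimensional cell complex; $\chi(G)$ denotes its Euler characteristic. The $n$-th ordered configuration space is $\mathrm{Conf}_n(G) = \{(x_1, \ldots, x_n) \in G^n : x_i \neq x_j \text{ for } i \neq j\}$ with the subspace topology from $G^n$. *)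

theory Defs
  imports "HOL-Analysis.Analysis"
begin

text \<open>
  A finite cell complex is a Hausdorff space partitioned into finitely many open cells, each
  with a characteristic map.  Closure-finiteness and the weak topology are automatic
  for finitely many cells.  Here \<open>V\<close> is the set of 0-cells (as points) and \<open>E\<close> the set of open
  1-cells (as subsets); loops and multiple edges are allowed.
\<close>

definition open_edge :: "'a topology \<Rightarrow> 'a set \<Rightarrow> 'a set \<Rightarrow> bool" where
  "open_edge X V e \<longleftrightarrow>
     (\<exists>\<phi> :: real \<Rightarrow> 'a.
        continuous_map (top_of_set {0..1}) X \<phi> \<and>
        homeomorphic_map (top_of_set {0<..<1}) (subtopology X e) \<phi> \<and>
        \<phi> 0 \<in> V \<and> \<phi> 1 \<in> V)"

definition graph_complex :: "'a topology \<Rightarrow> 'a set \<Rightarrow> 'a set set \<Rightarrow> bool" where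
  "graph_complex X V E \<longleftrightarrow>
     Hausdorff_space X \<and> connected_space X \<and>
     finite V \<and> finite E \<and> E \<noteq> {} \<and>
     (\<forall>e\<in>E. e \<subseteq> topspace X \<and> open_edge X V e) \<and>
     topspace X = V \<union> \<Union>E \<and> V \<inter> \<Union>E = {} \<and> pairwise disjnt E"

definition euler_characteristic :: "'a set \<Rightarrow> 'a set set \<Rightarrow> int" where
  "euler_characteristic V E = int (card V) - int (card E)"

text \<open>
  Points of \<open>X\<close> to the power \<open>n\<close> are functions on \<open>{1..n}\<close> that are \<open>undefined\<close> elsewhere, as
  in the library's product topology; hence forgetting the last coordinate is restriction.
\<close>

definition Conf :: "nat \<Rightarrow> 'a topology \<Rightarrow> (nat \<Rightarrow> 'a) topology" where
  "Conf n X = subtopology (product_topology (\<lambda>_. X) {1..n})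
     {x. \<forall>i\<in>{1..n}. \<forall>j\<in>{1..n}. i \<noteq> j \<longrightarrow> x i \<noteq> x j}"

text \<open>The map from configurations of \<open>n + 1\<close> points to configurations of \<open>n\<close> points.\<close>

definition forget_last :: "nat \<Rightarrow> (nat \<Rightarrow> 'a) \<Rightarrow> (nat \<Rightarrow> 'a)" where
  "forget_last n x = restrict x {1..n}"

end

theory Submission
  imports Defs
begin

text \<open>
  A section amounts to a continuous choice \<open>f x\<close> of a point of the graph different from all
  coordinates of \<open>x\<close>.  Put the points on the edges outside a spanning tree, at least one on each.
  Let one further point move in the tree-like complement \<open>T\<close> of the others: either \<open>f\<close> is
  trapped between two neighbours on an edge, or it is a fixed-point-free self-map of \<open>T\<close>.  Such a
  map sends each vertex away along exactly one half-edge and orients each tree edge; since a tree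
  has one edge fewer than vertices, exactly one open end of \<open>T\<close> is left over, i.e. the
  moving point has to approach exactly one end in order to trap \<open>f\<close>.  Hence in every such
  arrangement a unique ordered pair of neighbours \<open>a, b\<close> on some edge \<open>e\<close> traps \<open>f\<close>
  for a suitable position of the moving point.  A trap survives all moves of the other points, and
  by shunting these freely it depends on \<open>(e, a, b)\<close> only.  For a third point \<open>c\<close> the traps
  \<open>(e, a, c)\<close> and \<open>(e, c, b)\<close> also have to exist, and the order \<open>a, c, b\<close> on \<open>e\<close> then
  puts \<open>f\<close> into two disjoint gaps.
\<close>

section \<open>Arrangements of labels on edges\<close>

text \<open>Where the constants come from: with \<open>D\<close> the edges outside a spanning tree,
  \<open>card D = 1 - \<chi>(G)\<close>. Thus \<open>\<chi>(G) < 0\<close> means that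
  \<open>D\<close> has at least two edges, so that beside \<open>e\<close> there is always a second
  edge on which labels can be shunted, and \<open>n \<ge> 2 - \<chi>(G)\<close> means that with one
  label in motion the others can still occupy every edge of \<open>D\<close>. Occupation is
  essential: only then is each open end of \<open>T\<close> closed off by a label, so that a point
  pushed towards it is caught between two labels. The obstacle is that counting ends says nothing
  about two different arrangements of the resting labels. They are compared through the labels
  alone: topology enters through an abstract predicate on lists of labels, and the contradiction is
  purely combinatorial.\<close>

definition arrangement :: "'e set \<Rightarrow> nat set \<Rightarrow> ('e \<Rightarrow> nat list) \<Rightarrow> bool" where
  "arrangement D K W \<longleftrightarrow> (\<forall>d. distinct (W d)) \<and> (\<forall>d. d \<notin> D \<longrightarrow> W d = []) \<and>
     (\<forall>d d'. d \<noteq> d' \<longrightarrow> set (W d) \<inter> set (W d') = {}) \<and> (\<Union>d. set (W d)) = K"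

definition adjacent :: "nat list \<Rightarrow> nat \<Rightarrow> nat \<Rightarrow> bool" where
  "adjacent xs a b \<longleftrightarrow> (\<exists>u v. xs = u @ a # b # v)"

text \<open>A pair \<open>(e, b)\<close> is a half-edge, with \<open>b = True\<close> for the end at
  parameter 1. A label that enters an edge from a vertex can only become its first or its last
  letter.\<close>

definition attach :: "'e \<times> bool \<Rightarrow> nat \<Rightarrow> ('e \<Rightarrow> nat list) \<Rightarrow> 'e \<Rightarrow> nat list" where
  "attach h k W = W(fst h := if snd h then W (fst h) @ [k] else k # W (fst h))"

text \<open>Together with \<open>end_right\<close>: the two walls, in the order of the edge, of the
  gap between the attached \<open>k\<close> and the label next to it. On an empty edge
  \<open>last\<close> and \<open>hd\<close> are unspecified, hence the nonemptiness assumptions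
  further on.\<close>

definition end_left :: "'e \<times> bool \<Rightarrow> nat \<Rightarrow> ('e \<Rightarrow> nat list) \<Rightarrow> nat" where
  "end_left h k W = (if snd h then last (W (fst h)) else k)"

definition end_right :: "'e \<times> bool \<Rightarrow> nat \<Rightarrow> ('e \<Rightarrow> nat list) \<Rightarrow> nat" where
  "end_right h k W = (if snd h then k else hd (W (fst h)))"

lemma adjacentI: "xs = u @ a # b # v \<Longrightarrow> adjacent xs a b"
  unfolding adjacent_def by (intro exI)

lemma adjacent_append: "adjacent xs a b \<Longrightarrow> adjacent (xs @ ys) a b"
  unfolding adjacent_def by fastforce

lemma adjacent_Cons: "adjacent xs a b \<Longrightarrow> adjacent (x # xs) a b"
  unfolding adjacent_def by (metis append_Cons)

lemma adjacent_attach: "adjacent (W e) a b \<Longrightarrow> adjacent (attach h k W e) a b"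
  by (auto simp: attach_def adjacent_append adjacent_Cons)

lemma arrangement_attach:
  assumes "arrangement D (L - {k}) W" "k \<in> L" "fst h \<in> D"
  shows "arrangement D L (attach h k W)"
proof -
  have k: "k \<notin> set (W d)" for d using assms(1) unfolding arrangement_def by blast
  have "(\<Union>d. set (attach h k W d)) = insert k (\<Union>d. set (W d))"
    by (auto simp: attach_def split: if_splits)
  moreover have "(\<Union>d. set (W d)) = L - {k}"
    using assms(1) unfolding arrangement_def by blast
  ultimately have "(\<Union>d. set (attach h k W d)) = L" using assms(2) by auto
  moreover have "set (attach h k W d) \<inter> set (attach h k W d') = {}" if "d \<noteq> d'" for d d'
  proof -
    have "set (W d) \<inter> set (W d') = {}" using assms(1) that unfolding arrangement_def by blast
    then show ?thesis using that k by (auto simp: attach_def)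
  qed
  ultimately show ?thesis
    using assms k unfolding arrangement_def by (auto simp: attach_def)
qed

text \<open>An injection of \<open>B - {y}\<close> into \<open>A - {x}\<close> is inverted on its
  image; everything else, \<open>x\<close> included, goes to \<open>y\<close>.\<close>

lemma ex_surjection_prescribed:
  fixes A :: "'x set" and B :: "'y set"
  assumes "finite A" "finite B" "card B \<le> card A" "x \<in> A" "y \<in> B"
  obtains p where "p ` A = B" "p x = y"
proof -
  have "card (B - {y}) \<le> card (A - {x})" using assms by (simp add: card_Diff_singleton)
  then obtain q where q: "q ` (B - {y}) \<subseteq> A - {x}" "inj_on q (B - {y})"
    using card_le_inj[of "B - {y}" "A - {x}"] assms by auto
  define p where "p = (\<lambda>z. if z \<in> q ` (B - {y}) then the_inv_into (B - {y}) q z else y)"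
  have "x \<notin> q ` (B - {y})" using q by blast
  then have "p x = y" by (simp add: p_def)
  moreover have "p ` A = B"
  proof
    show "p ` A \<subseteq> B"
      using q assms(5) by (auto simp: p_def the_inv_into_f_f)
    show "B \<subseteq> p ` A"
    proof
      fix b assume "b \<in> B"
      show "b \<in> p ` A"
      proof (cases "b = y")
        case True then show ?thesis using \<open>p x = y\<close> assms(4) by blast
      next
        case False
        then have "p (q b) = b" using q \<open>b \<in> B\<close> by (auto simp: p_def the_inv_into_f_f)
        moreover have "q b \<in> A" using q False \<open>b \<in> B\<close> by auto
        ultimately show ?thesis by force
      qed
    qed
  qed
  ultimately show thesis using that by blast
qed

text \<open>A surjection of the labels other than \<open>x\<close> onto the edges other than
  \<open>e\<close>, sending \<open>y\<close> to \<open>e'\<close>, decides who goes where; the order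
  within an edge is free, so \<open>y\<close> can be put at either end.\<close>

lemma ex_arrangement:
  assumes "finite D" "finite K" "e \<in> D" "e' \<in> D" "e \<noteq> e'" "x \<in> K" "y \<in> K" "x \<noteq> y"
    and "card D \<le> card K"
  obtains W where "arrangement D K W" "\<forall>d\<in>D. W d \<noteq> []" "W e = [x]"
    "if right then last (W e') = y else hd (W e') = y"
proof -
  have "card (D - {e}) \<le> card (K - {x})" using assms by (simp add: card_Diff_singleton)
  then obtain p where p: "p ` (K - {x}) = D - {e}" "p y = e'"
    using ex_surjection_prescribed[of "K - {x}" "D - {e}" y e'] assms by auto
  define R where "R d = {l \<in> K - {x}. p l = d}" for d
  define W where "W d = (if d = e then [x] else if d = e' then
      (if right then sorted_list_of_set (R d - {y}) @ [y] else y # sorted_list_of_set (R d - {y}))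
      else sorted_list_of_set (R d))" for d
  have fin: "finite (R d)" for d using assms by (simp add: R_def)
  have yR: "y \<in> R e'" using p assms by (auto simp: R_def)
  have sW: "set (W d) = (if d = e then {x} else R d)" for d
    using fin yR by (auto simp: W_def)
  have "R d = {}" if "d \<notin> D" for d using p that by (auto simp: R_def)
  then have "W d = []" if "d \<notin> D" for d using that sW[of d] assms by (auto split: if_splits)
  moreover have "(\<Union>d. set (W d)) = K"
  proof -
    have "R e = {}" using p by (auto simp: R_def)
    then show ?thesis using sW assms by (auto simp: R_def split: if_splits)
  qed
  moreover have "distinct (W d)" for d using fin by (auto simp: W_def)
  moreover have "set (W d) \<inter> set (W d') = {}" if "d \<noteq> d'" for d d'
    using that unfolding sW by (auto simp: R_def)
  ultimately have "arrangement D K W" unfolding arrangement_def by blast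
  moreover have "W d \<noteq> []" if "d \<in> D" for d
  proof -
    have "R d \<noteq> {}" if "d \<noteq> e"
    proof -
      have "d \<in> p ` (K - {x})" using p(1) \<open>d \<in> D\<close> that by simp
      then show ?thesis by (auto simp: R_def)
    qed
    then have "set (W d) \<noteq> {}" unfolding sW by simp
    then show ?thesis by auto
  qed
  moreover have "W e = [x]" by (simp add: W_def)
  moreover have "if right then last (W e') = y else hd (W e') = y"
    using assms by (auto simp: W_def)
  ultimately show thesis using that by blast
qed

lemma arrangement_two:
  assumes "e \<in> D" "e' \<in> D" "e \<noteq> e'"
  shows "arrangement D K ((\<lambda>_. [])(e := x, e' := y)) \<longleftrightarrow> distinct (x @ y) \<and> K = set (x @ y)"
proof -
  let ?W = "(\<lambda>_. [])(e := x, e' := y)"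
  have "(\<Union>d. set (?W d)) = set (x @ y)"
    using assms by (auto split: if_splits)
  moreover have "(\<forall>d. distinct (?W d)) \<and> (\<forall>d d'. d \<noteq> d' \<longrightarrow> set (?W d) \<inter> set (?W d') = {}) \<longleftrightarrow>
      distinct (x @ y)" (is "?A \<and> ?B \<longleftrightarrow> ?C")
  proof
    assume AB: "?A \<and> ?B"
    then have "distinct (?W e)" "distinct (?W e')" "set (?W e) \<inter> set (?W e') = {}"
      using assms by blast+
    then show ?C using assms by auto
  next
    assume C: ?C
    have "distinct (?W d)" for d using C by auto
    moreover have "set (?W d) \<inter> set (?W d') = {}" if "d \<noteq> d'" for d d'
    proof -
      have "?W d = [] \<or> ?W d' = [] \<or> d = e \<and> d' = e' \<or> d = e' \<and> d' = e"
        using that assms by auto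
      moreover have "set (?W e) \<inter> set (?W e') = {}" using C assms by auto
      ultimately show ?thesis by (elim disjE) auto
    qed
    ultimately show "?A \<and> ?B" by blast
  qed
  moreover have "?W d = []" if "d \<notin> D" for d using assms that by (simp add: fun_upd_def) blast
  ultimately show ?thesis unfolding arrangement_def by metis
qed

text \<open>This is what the topology has to deliver, with \<open>Sel W e a b\<close> standing for:
  in the arrangement \<open>W\<close> the extra point is trapped between the neighbours
  \<open>a\<close>, \<open>b\<close> on \<open>e\<close>. In \<open>Sel_move\<close> the pair is
  adjacent before \<open>k\<close> is attached, so the move neither opens nor closes the gap.
  \<open>Sel_unique\<close> concerns a single arrangement, whereas \<open>Sel_end_unique\<close>
  compares several positions of \<open>k\<close> over the same resting labels.\<close>

locale gap_selection =
  fixes D :: "'e set" and L :: "nat set" and Sel :: "('e \<Rightarrow> nat list) \<Rightarrow> 'e \<Rightarrow> nat \<Rightarrow> nat \<Rightarrow> bool"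
  assumes finite_D: "finite D" and finite_L: "finite L"
    and card_D: "card D \<ge> 2" and card_L: "card L \<ge> card D + 1"
    and Sel_adjacent: "Sel W e a b \<Longrightarrow> arrangement D L W \<and> e \<in> D \<and> adjacent (W e) a b"
    and Sel_unique: "Sel W e a b \<Longrightarrow> Sel W e' a' b' \<Longrightarrow> e = e' \<and> a = a' \<and> b = b'"
    and Sel_move: "arrangement D (L - {k}) W \<Longrightarrow> k \<in> L \<Longrightarrow> adjacent (W e) a b \<Longrightarrow>
      fst h \<in> D \<Longrightarrow> fst h' \<in> D \<Longrightarrow> Sel (attach h k W) e a b \<Longrightarrow> Sel (attach h' k W) e a b"
    and Sel_end_unique: "arrangement D (L - {k}) W \<Longrightarrow> k \<in> L \<Longrightarrow> \<forall>d\<in>D. W d \<noteq> [] \<Longrightarrow>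
      Sel (attach h k W) (fst h) (end_left h k W) (end_right h k W) \<Longrightarrow>
      Sel (attach h' k W) (fst h') (end_left h' k W) (end_right h' k W) \<Longrightarrow> h = h'"
    and Sel_exists: "arrangement D (L - {k}) W \<Longrightarrow> k \<in> L \<Longrightarrow> \<forall>d\<in>D. W d \<noteq> [] \<Longrightarrow>
      \<exists>h e a b. fst h \<in> D \<and> Sel (attach h k W) e a b"
begin

section \<open>Shunting: a trap does not depend on the order of the other labels\<close>

lemma Sel_move_iff:
  assumes "arrangement D (L - {k}) W" "k \<in> L" "adjacent (W e) a b" "fst h \<in> D" "fst h' \<in> D"
  shows "Sel (attach h k W) e a b \<longleftrightarrow> Sel (attach h' k W) e a b"
  using Sel_move assms by blast

context
  fixes e e' :: 'e and a b :: nat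
  assumes e: "e \<in> D" "e' \<in> D" "e \<noteq> e'"
begin

text \<open>A shunting yard: \<open>a b\<close> stay on \<open>e\<close>, whose two outer parts are stacks,
  and \<open>e'\<close> is a free track; together they allow every permutation of the other letters.\<close>
definition yard :: "nat list \<Rightarrow> nat list \<Rightarrow> nat list \<Rightarrow> 'e \<Rightarrow> nat list" where
  "yard p y q = (\<lambda>_. [])(e := p @ [a, b] @ q, e' := y)"

lemma arrangement_yard:
  "arrangement D K (yard p y q) \<longleftrightarrow> distinct (p @ y @ q @ [a, b]) \<and> K = set (p @ y @ q @ [a, b])"
  using e by (auto simp: yard_def arrangement_two)

lemma adjacent_yard: "adjacent (yard p y q e) a b"
  using e by (intro adjacentI[of _ p _ _ q]) (simp add: yard_def)

text \<open>Only the last letter of the free track ever moves, so both sides are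
  \<open>attach\<close> applied to the same yard without \<open>k\<close>.\<close>

lemma yard_right:
  assumes "arrangement D L (yard p (y @ [k]) q)"
  shows "Sel (yard p (y @ [k]) q) e a b \<longleftrightarrow> Sel (yard p y (q @ [k])) e a b"
proof -
  have "distinct (p @ (y @ [k]) @ q @ [a, b])" "L = set (p @ (y @ [k]) @ q @ [a, b])"
    using assms unfolding arrangement_yard by blast+
  then have "L - {k} = set (p @ y @ q @ [a, b])" "k \<in> L" "distinct (p @ y @ q @ [a, b])" by auto
  then have 1: "arrangement D (L - {k}) (yard p y q)" "k \<in> L"
    unfolding arrangement_yard by blast+
  have "yard p (y @ [k]) q = attach (e', True) k (yard p y q)"
    "yard p y (q @ [k]) = attach (e, True) k (yard p y q)"
    using e by (auto simp: yard_def attach_def fun_eq_iff)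
  then show ?thesis using Sel_move_iff[OF 1 adjacent_yard] e by simp
qed

lemma yard_left:
  assumes "arrangement D L (yard p (y @ [k]) q)"
  shows "Sel (yard p (y @ [k]) q) e a b \<longleftrightarrow> Sel (yard (k # p) y q) e a b"
proof -
  have "distinct (p @ (y @ [k]) @ q @ [a, b])" "L = set (p @ (y @ [k]) @ q @ [a, b])"
    using assms unfolding arrangement_yard by blast+
  then have "L - {k} = set (p @ y @ q @ [a, b])" "k \<in> L" "distinct (p @ y @ q @ [a, b])" by auto
  then have 1: "arrangement D (L - {k}) (yard p y q)" "k \<in> L"
    unfolding arrangement_yard by blast+
  have "yard p (y @ [k]) q = attach (e', True) k (yard p y q)"
    "yard (k # p) y q = attach (e, False) k (yard p y q)"
    using e by (auto simp: yard_def attach_def fun_eq_iff)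
  then show ?thesis using Sel_move_iff[OF 1 adjacent_yard] e by simp
qed

text \<open>Letters popped one by one onto the right stack arrive there in reverse order.\<close>

lemma yard_rights:
  assumes "arrangement D L (yard p (y @ v) q)"
  shows "Sel (yard p (y @ v) q) e a b \<longleftrightarrow> Sel (yard p y (q @ rev v)) e a b"
  using assms
proof (induction v arbitrary: q rule: rev_induct)
  case (snoc x v)
  have "arrangement D L (yard p (y @ v) (q @ [x]))"
    using snoc.prems unfolding arrangement_yard by auto
  then show ?case using snoc.IH[of "q @ [x]"] yard_right[of p "y @ v" x q] snoc.prems by simp
qed simp

text \<open>Store \<open>v\<close> on the right stack and \<open>x\<close> on the left one, then
  bring back \<open>v\<close> before \<open>x\<close>. Being reversed twice, \<open>v\<close> keeps
  its order.\<close>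

lemma yard_to_end:
  assumes "arrangement D L (yard [] (u @ x # v) [])"
  shows "Sel (yard [] (u @ x # v) []) e a b \<longleftrightarrow> Sel (yard [] (u @ v @ [x]) []) e a b"
proof -
  have "arrangement D L (yard [] ((u @ [x]) @ v) [])" "arrangement D L (yard [] (u @ [x]) (rev v))"
    "arrangement D L (yard [x] (u @ v) [])" "arrangement D L (yard [] ((u @ v) @ [x]) [])"
    using assms unfolding arrangement_yard by auto
  then show ?thesis
    using yard_rights[of "[]" "u @ [x]" v "[]"] yard_left[of "[]" u x "rev v"]
      yard_rights[of "[x]" u v "[]"] yard_left[of "[]" "u @ v" x "[]"] by simp
qed

text \<open>Sending the letters of \<open>ys\<close> to the end one at a time leaves them there as a
  block in this order. With \<open>ys\<close> the whole target list this sorts the track.\<close>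

lemma yard_filter:
  assumes "arrangement D L (yard [] y [])" "distinct ys" "set ys \<subseteq> set y"
  shows "Sel (yard [] y []) e a b \<longleftrightarrow> Sel (yard [] (filter (\<lambda>l. l \<notin> set ys) y @ ys) []) e a b"
  using assms(2,3)
proof (induction ys rule: rev_induct)
  case (snoc x ys)
  let ?z = "filter (\<lambda>l. l \<notin> set ys) y"
  have d: "distinct y" using assms(1) unfolding arrangement_yard by auto
  have "x \<in> set ?z" using snoc.prems by auto
  then obtain u v where uv: "?z = u @ x # v" by (meson split_list)
  have dz: "distinct ?z" using d by simp
  have "filter (\<lambda>l. l \<notin> set (ys @ [x])) y = filter (\<lambda>l. l \<noteq> x) ?z"
    by (auto intro!: filter_cong)
  also have "\<dots> = u @ v"
  proof -
    have "x \<notin> set u" "x \<notin> set v" using dz unfolding uv by auto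
    then have "filter (\<lambda>l. l \<noteq> x) u = u" "filter (\<lambda>l. l \<noteq> x) v = v"
      by (auto simp: filter_id_conv)
    then show ?thesis unfolding uv by simp
  qed
  finally have eq: "filter (\<lambda>l. l \<notin> set (ys @ [x])) y = u @ v" .
  have "set (?z @ ys) = set y" using snoc.prems by auto
  moreover have "distinct (?z @ ys)" using dz snoc.prems by auto
  ultimately have "arrangement D L (yard [] (?z @ ys) [])"
    using assms(1) unfolding arrangement_yard by auto
  then have "arrangement D L (yard [] (u @ x # (v @ ys)) [])" using uv by simp
  from yard_to_end[OF this] show ?case using snoc uv eq by simp
qed simp

lemma yard_permute:
  assumes "arrangement D L (yard [] y [])" "arrangement D L (yard [] y' [])"
  shows "Sel (yard [] y []) e a b \<longleftrightarrow> Sel (yard [] y' []) e a b"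
proof -
  have s: "distinct y" "distinct y'" "set y' = L - {a,b}" "set y = L - {a,b}"
    using assms unfolding arrangement_yard by auto
  then have "filter (\<lambda>l. l \<notin> set y') y = []" by (simp add: filter_empty_conv)
  then show ?thesis using yard_filter[OF assms(1), of y'] s by simp
qed

text \<open>The labels other than \<open>a\<close> and \<open>b\<close> move to the free track one
  at a time: as long as some are missing, the first letter before \<open>a b\<close>, the last one
  behind it, or the last one on a third edge can be taken. The number of labels not yet on
  \<open>e'\<close> decreases.\<close>

lemma gather:
  assumes "arrangement D L W" "adjacent (W e) a b"
  shows "\<exists>y. arrangement D L (yard [] y []) \<and> (Sel W e a b \<longleftrightarrow> Sel (yard [] y []) e a b)"
  using assms
proof (induction "card (L - set (W e'))" arbitrary: W rule: less_induct)
  case less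
  obtain u v where uv: "W e = u @ a # b # v" using less.prems unfolding adjacent_def by blast
  show ?case
  proof (cases "u = [] \<and> v = [] \<and> (\<forall>d. d \<noteq> e \<and> d \<noteq> e' \<longrightarrow> W d = [])")
    case True
    then have "W = yard [] (W e') []" using uv by (auto simp: yard_def fun_eq_iff)
    then show ?thesis using less.prems by metis
  next
    case False
    have "\<exists>h k W0. W = attach h k W0 \<and> adjacent (W0 e) a b \<and> fst h \<noteq> e' \<and> k \<notin> set (W0 (fst h))"
    proof -
      have dis: "distinct (W d)" for d using less.prems unfolding arrangement_def by blast
      consider (u) z u' where "u = z # u'" | (v) v' z where "v = v' @ [z]"
        | (d) d w z where "d \<noteq> e" "d \<noteq> e'" "W d = w @ [z]"
        using False by (metis list.exhaust rev_exhaust)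
      then show ?thesis
      proof cases
        case u
        have "W = attach (e, False) z (W(e := u' @ a # b # v))"
          using u uv by (auto simp: attach_def fun_eq_iff)
        moreover have "z \<notin> set (u' @ a # b # v)" using dis[of e] uv u by simp
        ultimately show ?thesis using e unfolding adjacent_def by fastforce
      next
        case v
        have "W = attach (e, True) z (W(e := u @ a # b # v'))"
          using v uv by (auto simp: attach_def fun_eq_iff)
        moreover have "z \<notin> set (u @ a # b # v')" using dis[of e] uv v by auto
        ultimately show ?thesis using e unfolding adjacent_def by fastforce
      next
        case d
        have "W = attach (d, True) z (W(d := w))"
          using d by (auto simp: attach_def fun_eq_iff)
        moreover have "z \<notin> set w" using dis[of d] d by auto
        ultimately show ?thesis using d uv unfolding adjacent_def by fastforce
      qed
    qed
    then obtain h k W0 where W0: "W = attach h k W0" "adjacent (W0 e) a b" "fst h \<noteq> e'"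
      "k \<notin> set (W0 (fst h))" by blast
    have dj: "set (W d) \<inter> set (W d') = {}" if "d \<noteq> d'" for d d'
      using less.prems(1) that unfolding arrangement_def by blast
    have W0W: "set (W0 d) \<subseteq> set (W d)" for d unfolding W0(1) attach_def by auto
    have kh: "k \<in> set (W (fst h))" unfolding W0(1) by (simp add: attach_def)
    have knd: "k \<notin> set (W0 d)" for d
      using dj[of d "fst h"] kh W0W[of d] W0(4) by (cases "d = fst h") auto
    have kL: "k \<in> L" using kh less.prems unfolding arrangement_def by blast
    have fD: "fst h \<in> D" using kh less.prems unfolding arrangement_def by force
    have "arrangement D (L - {k}) W0"
    proof -
      have "(\<Union>d. set (W d)) = L" using less.prems unfolding arrangement_def by blast
      moreover have "(\<Union>d. set (W d)) = insert k (\<Union>d. set (W0 d))"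
        unfolding W0(1) by (auto simp: attach_def split: if_splits)
      ultimately have "(\<Union>d. set (W0 d)) = L - {k}" using knd by auto
      moreover have "distinct (W0 d)" for d
      proof -
        have "distinct (attach h k W0 d)" using less.prems W0 unfolding arrangement_def by blast
        then show ?thesis by (auto simp: attach_def split: if_splits)
      qed
      moreover have "W0 d = []" if "d \<notin> D" for d
        using W0W[of d] that less.prems unfolding arrangement_def by auto
      moreover have "set (W0 d) \<inter> set (W0 d') = {}" if "d \<noteq> d'" for d d'
        using dj[OF that] W0W by blast
      ultimately show ?thesis unfolding arrangement_def by blast
    qed
    note A = this
    let ?W' = "attach (e', True) k W0"
    have arr: "arrangement D L ?W'" using arrangement_attach[OF A kL] e by simp
    have adj: "adjacent (?W' e) a b" using W0 by (intro adjacent_attach)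
    have "card (L - set (?W' e')) < card (L - set (W e'))"
    proof (rule psubset_card_mono)
      have "W e' = W0 e'" using W0 by (simp add: attach_def)
      moreover have "k \<notin> set (W0 e')" by (rule knd)
      ultimately show "L - set (?W' e') \<subset> L - set (W e')"
        using kL by (auto simp: attach_def)
    qed (use finite_L in simp)
    from less.hyps[OF this arr adj]
    show ?thesis using Sel_move_iff[OF A kL W0(2) fD, of "(e', True)"] e W0(1) by auto
  qed
qed

lemma Sel_iff_Sel:
  assumes "arrangement D L W" "adjacent (W e) a b" "arrangement D L W'" "adjacent (W' e) a b"
  shows "Sel W e a b \<longleftrightarrow> Sel W' e a b"
  using gather[OF assms(1,2)] gather[OF assms(3,4)] yard_permute by metis

end

section \<open>The relation of trapping pairs\<close>

definition Rel :: "'e \<Rightarrow> nat \<Rightarrow> nat \<Rightarrow> bool" where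
  "Rel e a b \<longleftrightarrow> (\<exists>W. Sel W e a b)"

lemma other_edge: obtains e' where "e' \<in> D" "e \<noteq> e'"
proof -
  have "\<not> D \<subseteq> {e}" using card_D card_mono[of "{e}" D] by auto
  then show thesis using that by blast
qed

text \<open>By shunting, the existential quantifier in \<open>Rel\<close> is as good as a universal
  one.\<close>

lemma RelD:
  assumes "Rel e a b" "arrangement D L W" "adjacent (W e) a b"
  shows "Sel W e a b"
proof -
  obtain W' where W': "Sel W' e a b" using assms(1) unfolding Rel_def by blast
  obtain e' where "e' \<in> D" "e \<noteq> e'" by (rule other_edge)
  then show ?thesis using Sel_iff_Sel[of e e'] Sel_adjacent[OF W'] W' assms(2,3) by blast
qed

lemma Rel_props:
  assumes "Rel e a b"
  shows "e \<in> D" "a \<in> L" "b \<in> L" "a \<noteq> b"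
proof -
  obtain W where W: "Sel W e a b" using assms(1) unfolding Rel_def by blast
  then obtain u v where uv: "W e = u @ a # b # v" and arr: "arrangement D L W" and "e \<in> D"
    using Sel_adjacent unfolding adjacent_def by blast
  show "e \<in> D" by fact
  have "distinct (W e)" "set (W e) \<subseteq> L" using arr unfolding arrangement_def by blast+
  then show "a \<in> L" "b \<in> L" "a \<noteq> b" using uv by auto
qed

text \<open>Otherwise \<open>a, b, c\<close> in a row on \<open>e\<close> would be an arrangement
  with two traps. The case \<open>a = c\<close> stays open, because \<open>a, b, a\<close> is no
  arrangement.\<close>

lemma Rel_path:
  assumes "Rel e a b" "Rel e b c" shows "a = c"
proof (rule ccontr)
  assume ac: "a \<noteq> c"
  note p = Rel_props[OF assms(1)] Rel_props[OF assms(2)]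
  obtain e' where e': "e' \<in> D" "e \<noteq> e'" by (rule other_edge)
  define W where "W = (\<lambda>_. [])(e := [a, b, c], e' := sorted_list_of_set (L - {a, b, c}))"
  have "arrangement D L W"
    using p e' finite_L ac unfolding W_def arrangement_two[OF p(1) e'] by auto
  moreover have "adjacent (W e) a b" "adjacent (W e) b c"
    using e' by (auto simp: W_def intro: adjacentI[of _ "[]"] adjacentI[of _ "[a]"])
  ultimately have "Sel W e a b" "Sel W e b c" using RelD assms by blast+
  then show False using Sel_unique p by blast
qed

text \<open>Pairs without a common label fit into one arrangement, which would then have two
  traps.\<close>

lemma Rel_disjoint:
  assumes "Rel e a b" "Rel e' c d" "e \<noteq> e'" shows "{a, b} \<inter> {c, d} \<noteq> {}"
proof
  assume dj: "{a, b} \<inter> {c, d} = {}"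
  note p = Rel_props[OF assms(1)] Rel_props[OF assms(2)]
  define W where "W = (\<lambda>_. [])(e := [a, b], e' := [c, d] @ sorted_list_of_set (L - {a, b, c, d}))"
  have "arrangement D L W"
    using p finite_L dj unfolding W_def arrangement_two[OF p(1) p(5) assms(3)] by auto
  moreover have "adjacent (W e) a b" "adjacent (W e') c d"
    using assms(3) by (auto simp: W_def intro: adjacentI[of _ "[]"])
  ultimately have "Sel W e a b" "Sel W e' c d" using RelD assms by blast+
  then show False using Sel_unique assms(3) by blast
qed

text \<open>If only one label \<open>k\<close> is common, let it be the moving one: with its partner
  \<open>x\<close> alone on \<open>e\<close> and its partner \<open>y\<close> at the suitable end of
  \<open>e'\<close>, attaching \<open>k\<close> to either edge completes one of the pairs, so two
  different ends would trap.\<close>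

lemma Rel_share:
  assumes "Rel e a b" "Rel e' c d" "e \<noteq> e'"
  shows "{a, b} = {c, d}"
proof (rule ccontr)
  assume ne: "{a, b} \<noteq> {c, d}"
  note p = Rel_props[OF assms(1)] Rel_props[OF assms(2)]
  obtain k where k: "k \<in> {a, b}" "k \<in> {c, d}" using Rel_disjoint[OF assms] by blast
  define x where "x = (if k = a then b else a)"
  define y where "y = (if k = c then d else c)"
  have ab: "(a = x \<and> b = k) \<or> (a = k \<and> b = x)" "(c = y \<and> d = k) \<or> (c = k \<and> d = y)"
    using k by (auto simp: x_def y_def)
  have xy: "x \<noteq> y" "x \<noteq> k" "y \<noteq> k" "x \<in> L" "y \<in> L" "k \<in> L" using ab ne p by auto
  \<comment> \<open>Without \<open>k\<close> there are still \<open>card D\<close> labels, so no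
    edge has to stay empty.\<close>
  have "card D \<le> card (L - {k})" using card_L xy finite_L by simp
  then obtain W where W: "arrangement D (L - {k}) W" "\<forall>d\<in>D. W d \<noteq> []" "W e = [x]"
    "if d = k then last (W e') = y else hd (W e') = y"
    using ex_arrangement[of D "L - {k}" e e' x y "d = k"] finite_D finite_L p assms(3) xy by auto
  \<comment> \<open>\<open>k\<close> joins an edge at its right end exactly if it is the second
    label of the pair to be formed.\<close>
  let ?h = "(e, b = k)" and ?h' = "(e', d = k)"
  have "W e' \<noteq> []" using W p by blast
  have "adjacent (attach ?h' k W e') c d"
  proof (cases "d = k")
    case True
    then have "W e' = butlast (W e') @ [c]" using ab W(4) \<open>W e' \<noteq> []\<close> xy
      by (metis append_butlast_last_id)
    then have "attach ?h' k W e' = butlast (W e') @ c # d # []"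
      using True by (simp add: attach_def)
    then show ?thesis by (rule adjacentI)
  next
    case False
    then have "W e' = d # tl (W e')" "c = k" using ab W(4) \<open>W e' \<noteq> []\<close> xy
      by (metis list.collapse)+
    then have "attach ?h' k W e' = [] @ c # d # tl (W e')"
      using False by (simp add: attach_def)
    then show ?thesis by (rule adjacentI)
  qed
  moreover have "adjacent (attach ?h k W e) a b"
    using ab xy W(3) by (auto simp: attach_def intro: adjacentI[of _ "[]"])
  moreover have "arrangement D L (attach ?h k W)" "arrangement D L (attach ?h' k W)"
    using arrangement_attach[OF W(1) xy(6)] p by auto
  ultimately have S: "Sel (attach ?h k W) e a b" "Sel (attach ?h' k W) e' c d"
    using RelD assms by blast+
  have E: "end_left ?h k W = a" "end_right ?h k W = b" "end_left ?h' k W = c" "end_right ?h' k W = d"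
    using ab xy W(3,4) by (auto simp: end_left_def end_right_def)
  have "?h = ?h'"
    by (rule Sel_end_unique[OF W(1) xy(6) W(2)]) (simp_all only: E fst_conv S)
  then show False using assms(3) by simp
qed

text \<open>With \<open>x\<close> alone on \<open>e\<close> and \<open>c\<close> moving, a trap
  exists somewhere. On another edge it would consist of \<open>a\<close> and \<open>b\<close> by
  \<open>Rel_share\<close>, although \<open>x\<close> is on \<open>e\<close>; on \<open>e\<close>
  only \<open>x\<close> and \<open>c\<close> can form it.\<close>

lemma third_letter:
  assumes "Rel e a b" "c \<in> L" "c \<noteq> a" "c \<noteq> b" "x \<in> {a, b}"
  shows "Rel e x c \<or> Rel e c x"
proof -
  note p = Rel_props[OF assms(1)]
  define y where "y = (if x = a then b else a)"
  have y: "y \<in> {a, b}" "y \<noteq> x" using p assms by (auto simp: y_def)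
  have xy: "{x, y} = {a, b}" using y assms by auto
  obtain e' where e': "e' \<in> D" "e \<noteq> e'" by (rule other_edge)
  have "card D \<le> card (L - {c})" using card_L assms finite_L by simp
  then obtain W where W: "arrangement D (L - {c}) W" "\<forall>d\<in>D. W d \<noteq> []" "W e = [x]"
    using ex_arrangement[of D "L - {c}" e e' x y True] finite_D finite_L p assms e' y by auto
  obtain h e1 p1 q1 where h: "fst h \<in> D" "Sel (attach h c W) e1 p1 q1"
    using Sel_exists[OF W(1) assms(2) W(2)] by blast
  have rel: "Rel e1 p1 q1" using h unfolding Rel_def by blast
  have adj: "adjacent (attach h c W e1) p1 q1" using Sel_adjacent[OF h(2)] by simp
  then obtain u v where uv: "attach h c W e1 = u @ p1 # q1 # v" unfolding adjacent_def by blast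
  show ?thesis
  proof (cases "e1 = e")
    case True
    then have "{p1, q1} = {x, c}" using uv W(3) by (auto simp: attach_def Cons_eq_append_conv append_eq_Cons_conv split: if_splits)
    then show ?thesis using rel True p assms by (auto simp: doubleton_eq_iff)
  next
    case False
    then have "{p1, q1} = {a, b}" using Rel_share[OF rel assms(1)] by simp
    then have "x \<in> {p1, q1}" using assms by blast
    then have "x \<in> set (attach h c W e1)" using uv by auto
    moreover have "x \<in> set (attach h c W e)" using W(3) by (auto simp: attach_def)
    moreover have "arrangement D L (attach h c W)" using Sel_adjacent[OF h(2)] by simp
    ultimately show ?thesis using False unfolding arrangement_def by blast
  qed
qed

theorem gap_selection_False: False
proof -
  have cL: "card L \<ge> 3" using card_L card_D by simp
  obtain e1 where e1: "e1 \<in> D" using other_edge by blast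
  obtain e2 where e2: "e2 \<in> D" "e1 \<noteq> e2" using other_edge by blast
  have ex: "\<exists>l\<in>L. l \<notin> S" if "card S \<le> 2" "finite S" for S
  proof -
    have "\<not> L \<subseteq> S" using card_mono[of S L] that cL by auto
    then show ?thesis by blast
  qed
  obtain k where k: "k \<in> L" using ex[of "{}"] by auto
  obtain x where x: "x \<in> L" "x \<noteq> k" using ex[of "{k}"] by auto
  obtain y where y: "y \<in> L" "y \<notin> {x, k}" using ex[of "{x, k}"] x by (auto simp: card_insert_if)
  have "card D \<le> card (L - {k})" using card_L k finite_L by simp
  then obtain W where W: "arrangement D (L - {k}) W" "\<forall>d\<in>D. W d \<noteq> []"
    using ex_arrangement[of D "L - {k}" e1 e2 x y True] finite_D finite_L e1 e2 x y by auto
  then obtain e a b where R: "Rel e a b" using Sel_exists[OF W(1) k W(2)] unfolding Rel_def by blast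
  note p = Rel_props[OF R]
  obtain c where c: "c \<in> L" "c \<notin> {a, b}" using ex[of "{a, b}"] p by (auto simp: card_insert_if)
  \<comment> \<open>\<open>third_letter\<close> allows two orders, and \<open>Rel_path\<close>
    excludes the one that continues the pair \<open>(a, b)\<close> to a path of three labels. The
    surviving pairs \<open>(a, c)\<close> and \<open>(c, b)\<close> then form such a path
    themselves.\<close>
  have "Rel e c b"
    using third_letter[OF R c(1), of b] Rel_path[OF R, of c] c by auto
  moreover have "Rel e a c"
    using third_letter[OF R c(1), of a] Rel_path[OF _ R, of c] c by auto
  ultimately show False using Rel_path p(4) by blast
qed

end

section \<open>Spanning trees\<close>

definition crosses :: "('e \<Rightarrow> 'v) \<Rightarrow> ('e \<Rightarrow> 'v) \<Rightarrow> 'e \<Rightarrow> 'v set \<Rightarrow> bool" where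
  "crosses src tgt e A \<longleftrightarrow> (src e \<in> A) \<noteq> (tgt e \<in> A)"

text \<open>A tree encoded by cuts instead of paths: every separating vertex set is crossed, which
  is connectedness, and every edge is the only one to cross some set, so it is a bridge. These cuts
  later provide the far side of a half-edge.\<close>

definition tree_on :: "('e \<Rightarrow> 'v) \<Rightarrow> ('e \<Rightarrow> 'v) \<Rightarrow> 'v set \<Rightarrow> 'e set \<Rightarrow> bool" where
  "tree_on src tgt R F \<longleftrightarrow> (\<forall>e\<in>F. src e \<in> R \<and> tgt e \<in> R) \<and>
    (\<forall>A. A \<inter> R \<noteq> {} \<longrightarrow> R - A \<noteq> {} \<longrightarrow> (\<exists>e\<in>F. crosses src tgt e A)) \<and>
    (\<forall>e\<in>F. \<exists>A. src e \<in> A \<and> tgt e \<notin> A \<and> (\<forall>e'\<in>F - {e}. \<not> crosses src tgt e' A))"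

lemma tree_onD:
  assumes "tree_on src tgt R F"
  shows "e \<in> F \<Longrightarrow> src e \<in> R \<and> tgt e \<in> R"
    and "A \<inter> R \<noteq> {} \<Longrightarrow> R - A \<noteq> {} \<Longrightarrow> \<exists>e\<in>F. crosses src tgt e A"
    and "e \<in> F \<Longrightarrow> \<exists>A. src e \<in> A \<and> tgt e \<notin> A \<and> (\<forall>e'\<in>F - {e}. \<not> crosses src tgt e' A)"
proof -
  note t = assms[unfolded tree_on_def]
  show "e \<in> F \<Longrightarrow> src e \<in> R \<and> tgt e \<in> R"
    by (rule t[THEN conjunct1, THEN bspec])
  show "A \<inter> R \<noteq> {} \<Longrightarrow> R - A \<noteq> {} \<Longrightarrow> \<exists>e\<in>F. crosses src tgt e A"
    by (rule t[THEN conjunct2, THEN conjunct1, THEN spec, THEN mp, THEN mp])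
  show "e \<in> F \<Longrightarrow> \<exists>A. src e \<in> A \<and> tgt e \<notin> A \<and> (\<forall>e'\<in>F - {e}. \<not> crosses src tgt e' A)"
    by (rule t[THEN conjunct2, THEN conjunct2, THEN bspec])
qed

text \<open>A graph edge leaving \<open>R\<close> adds its outer end \<open>z\<close> as a leaf. The
  new edge is cut off by \<open>{z}\<close> or by its complement, whichever contains the source; an
  old cut is adjusted by putting \<open>z\<close> on the side of its neighbour
  \<open>y\<close>.\<close>

lemma spanning_tree_grow:
  fixes src tgt :: "'e \<Rightarrow> 'v"
  assumes fin: "finite V" "finite E" and ends: "\<And>e. e \<in> E \<Longrightarrow> src e \<in> V \<and> tgt e \<in> V"
    and conn: "\<And>A. A \<subseteq> V \<Longrightarrow> A \<noteq> {} \<Longrightarrow> A \<noteq> V \<Longrightarrow> \<exists>e\<in>E. crosses src tgt e A"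
    and "Suc k \<le> card V"
  shows "\<exists>R F. R \<subseteq> V \<and> F \<subseteq> E \<and> card R = Suc k \<and> card F = k \<and> tree_on src tgt R F"
  using assms(5)
proof (induction k)
  case 0
  then obtain v where "v \<in> V" by fastforce
  then show ?case by (intro exI[of _ "{v}"] exI[of _ "{}"]) (auto simp: tree_on_def)
next
  case (Suc k)
  have "Suc k \<le> card V" using Suc.prems by simp
  then obtain R F where RF: "R \<subseteq> V" "F \<subseteq> E" "card R = Suc k" "card F = k" and t: "tree_on src tgt R F"
    using Suc.IH by blast
  note tD = tree_onD[OF t]
  have finR: "finite R" using RF fin finite_subset by blast
  have finF: "finite F" using RF fin finite_subset by blast
  have "R \<noteq> {}" "R \<noteq> V" using RF Suc.prems by auto
  then obtain g where g: "g \<in> E" "crosses src tgt g R" using conn RF by blast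
  define y z where "y = (if src g \<in> R then src g else tgt g)" and "z = (if src g \<in> R then tgt g else src g)"
  have yz: "y \<in> R" "z \<notin> R" "z \<in> V" using g ends[OF g(1)] by (auto simp: y_def z_def crosses_def)
  have cg: "crosses src tgt g A \<longleftrightarrow> (y \<in> A) \<noteq> (z \<in> A)" for A
    by (auto simp: crosses_def y_def z_def)
  have gF: "g \<notin> F" using tD(1)[of g] g by (auto simp: crosses_def)
  have c2: "\<exists>e\<in>insert g F. crosses src tgt e A" if A: "A \<inter> insert z R \<noteq> {}" "insert z R - A \<noteq> {}" for A
  proof (cases "(y \<in> A) = (z \<in> A)")
    case True
    then have "A \<inter> R \<noteq> {}" "R - A \<noteq> {}" using A yz by auto
    then show ?thesis using tD(2) by blast
  qed (use cg in blast)
  have c3: "\<exists>A. src e \<in> A \<and> tgt e \<notin> A \<and> (\<forall>e'\<in>insert g F - {e}. \<not> crosses src tgt e' A)"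
    if e: "e \<in> insert g F" for e
  proof (cases "e = g")
    case True
    have *: "\<not> crosses src tgt e' {z}" "\<not> crosses src tgt e' (- {z})" if "e' \<in> F" for e'
      using tD(1)[OF that] yz by (auto simp: crosses_def)
    show ?thesis
    proof (cases "src g \<in> R")
      case T: True
      then have "src g \<in> - {z}" "tgt g \<notin> - {z}" using yz by (auto simp: z_def)
      then show ?thesis using * True by (intro exI[of _ "- {z}"]) auto
    next
      case F: False
      then have "src g \<in> {z}" "tgt g \<notin> {z}" using g yz by (auto simp: z_def crosses_def)
      then show ?thesis using * True by (intro exI[of _ "{z}"]) auto
    qed
  next
    case False
    then have eF: "e \<in> F" using e by blast
    from tD(3)[OF this] obtain A where A0: "src e \<in> A \<and> tgt e \<notin> A \<and> (\<forall>e'\<in>F - {e}. \<not> crosses src tgt e' A)"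
      by (rule exE)
    note A = A0[THEN conjunct1] A0[THEN conjunct2, THEN conjunct1] A0[THEN conjunct2, THEN conjunct2, THEN bspec]
    define A' where "A' = (if y \<in> A then insert z A else A - {z})"
    have A'R: "x \<in> A' \<longleftrightarrow> x \<in> A" if "x \<in> R" for x using that yz by (auto simp: A'_def)
    have "\<not> crosses src tgt g A'" using yz by (auto simp: cg A'_def)
    moreover have "\<not> crosses src tgt e' A'" if "e' \<in> F - {e}" for e'
      using A(3)[OF that] A'R tD(1) that by (auto simp: crosses_def)
    moreover have "src e \<in> A'" "tgt e \<notin> A'" using A A'R tD(1)[OF eF] by auto
    ultimately show ?thesis by (intro exI[of _ A']) auto
  qed
  have c1: "src e \<in> insert z R \<and> tgt e \<in> insert z R" if "e \<in> insert g F" for e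
    using that tD(1) by (auto simp: y_def z_def) (use yz g in \<open>auto simp: z_def y_def crosses_def\<close>)
  have "card (insert z R) = Suc (Suc k)" "card (insert g F) = Suc k"
    using yz gF finR finF RF by auto
  moreover have "insert z R \<subseteq> V" "insert g F \<subseteq> E" using RF yz g by auto
  moreover have "tree_on src tgt (insert z R) (insert g F)"
    unfolding tree_on_def
  proof (intro conjI ballI allI impI)
    show "src e \<in> insert z R" "tgt e \<in> insert z R" if "e \<in> insert g F" for e
      using c1[OF that] by simp_all
    show "\<exists>e\<in>insert g F. crosses src tgt e A" if "A \<inter> insert z R \<noteq> {}" "insert z R - A \<noteq> {}" for A
      by (rule c2[OF that])
    show "\<exists>A. src e \<in> A \<and> tgt e \<notin> A \<and> (\<forall>e'\<in>insert g F - {e}. \<not> crosses src tgt e' A)"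
      if "e \<in> insert g F" for e by (rule c3[OF that])
  qed
  ultimately show ?case by blast
qed

lemma spanning_tree:
  fixes src tgt :: "'e \<Rightarrow> 'v"
  assumes fin: "finite V" "finite E" "V \<noteq> {}" and ends: "\<And>e. e \<in> E \<Longrightarrow> src e \<in> V \<and> tgt e \<in> V"
    and conn: "\<And>A. A \<subseteq> V \<Longrightarrow> A \<noteq> {} \<Longrightarrow> A \<noteq> V \<Longrightarrow> \<exists>e\<in>E. crosses src tgt e A"
  obtains F side where "F \<subseteq> E" "card F + 1 = card V"
    "\<And>A. A \<inter> V \<noteq> {} \<Longrightarrow> V - A \<noteq> {} \<Longrightarrow> \<exists>e\<in>F. crosses src tgt e A"
    "\<And>e. e \<in> F \<Longrightarrow> src e \<in> side e \<and> tgt e \<notin> side e"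
    "\<And>e e'. e \<in> F \<Longrightarrow> e' \<in> F \<Longrightarrow> e' \<noteq> e \<Longrightarrow> \<not> crosses src tgt e' (side e)"
proof -
  have "Suc (card V - 1) \<le> card V" using fin by (simp add: card_gt_0_iff Suc_leI)
  from spanning_tree_grow[OF fin(1,2) ends conn this]
  obtain R F where RF: "R \<subseteq> V" "F \<subseteq> E" "card R = Suc (card V - 1)" "card F = card V - 1"
      and t: "tree_on src tgt R F" by blast
  have c: "card V > 0" using fin by (simp add: card_gt_0_iff)
  then have "R = V" using RF fin by (simp add: card_subset_eq)
  have "\<forall>e. \<exists>A. e \<in> F \<longrightarrow> src e \<in> A \<and> tgt e \<notin> A \<and> (\<forall>e'\<in>F - {e}. \<not> crosses src tgt e' A)"
    using tree_onD(3)[OF t] by blast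
  from choice[OF this] obtain side where side: "\<And>e. e \<in> F \<Longrightarrow> src e \<in> side e \<and> tgt e \<notin> side e \<and>
      (\<forall>e'\<in>F - {e}. \<not> crosses src tgt e' (side e))" by blast
  show thesis
  proof (rule that)
    show "F \<subseteq> E" by fact
    show "card F + 1 = card V" using RF c by simp
    show "\<exists>e\<in>F. crosses src tgt e A" if "A \<inter> V \<noteq> {}" "V - A \<noteq> {}" for A
      using tree_onD(2)[OF t, of A] that \<open>R = V\<close> by simp
    show "src e \<in> side e \<and> tgt e \<notin> side e" if "e \<in> F" for e using side[OF that] by simp
    show "\<not> crosses src tgt e' (side e)" if "e \<in> F" "e' \<in> F" "e' \<noteq> e" for e e'
      using side[OF that(1)] that by simp
  qed
qed

section \<open>Half-edges and their far sides\<close>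

locale tree_sides =
  fixes V :: "'v set" and F :: "'e set" and src tgt :: "'e \<Rightarrow> 'v" and side :: "'e \<Rightarrow> 'v set"
  assumes tree_connected: "A \<inter> V \<noteq> {} \<Longrightarrow> V - A \<noteq> {} \<Longrightarrow> \<exists>e\<in>F. crosses src tgt e A"
    and side_ends: "e \<in> F \<Longrightarrow> src e \<in> side e \<and> tgt e \<notin> side e"
    and side_other: "e \<in> F \<Longrightarrow> e' \<in> F \<Longrightarrow> e' \<noteq> e \<Longrightarrow> \<not> crosses src tgt e' (side e)"
begin

definition base :: "'e \<times> bool \<Rightarrow> 'v" where
  "base h = (if snd h then tgt (fst h) else src (fst h))"

text \<open>The part of the tree seen from \<open>base h\<close> through the edge. A half-edge
  outside the tree leads to an open end, with no vertex behind it.\<close>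

definition far :: "'e \<times> bool \<Rightarrow> 'v set" where
  "far h = (if fst h \<notin> F then {} else if snd h then side (fst h) else - side (fst h))"

lemma base_far: "base h \<notin> far h"
  using side_ends by (auto simp: base_def far_def)

lemma far_other: "e \<in> F \<Longrightarrow> e \<noteq> fst h \<Longrightarrow> src e \<in> far h \<longleftrightarrow> tgt e \<in> far h"
  using side_other[of "fst h" e] by (auto simp: far_def crosses_def)

lemma far_opposite: "fst h \<in> F \<Longrightarrow> base (fst h, \<not> snd h) \<in> far h"
  using side_ends by (auto simp: base_def far_def)

text \<open>Let \<open>Z\<close> be everything other than \<open>v\<close> that lies beyond no
  half-edge at \<open>v\<close>. No tree edge crosses \<open>Z\<close>, and \<open>Z\<close> misses
  \<open>v\<close>, so by connectedness it contains no vertex.\<close>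

lemma ex_far:
  assumes "v \<in> V" "w \<in> V" "v \<noteq> w"
  obtains h where "fst h \<in> F" "base h = v" "w \<in> far h"
proof -
  define Z where "Z = - insert v (\<Union>{far h | h. fst h \<in> F \<and> base h = v})"
  have "\<not> crosses src tgt e Z" if e: "e \<in> F" for e
  proof
    assume "crosses src tgt e Z"
    then obtain b where b: "base (e, b) \<in> Z" "base (e, \<not> b) \<notin> Z"
      by (cases "src e \<in> Z") (auto simp: crosses_def base_def split: if_splits)
    show False
    proof (cases "base (e, \<not> b) = v")
      case True
      have "base (e, b) \<in> far (e, \<not> b)" using far_opposite[of "(e, \<not> b)"] e by simp
      then show False using b(1) True e unfolding Z_def by force
    next
      case False
      then obtain h where h: "fst h \<in> F" "base h = v" "base (e, \<not> b) \<in> far h"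
        using b(2) unfolding Z_def by blast
      have nb: "base (e, b) \<notin> far h" using b(1) h unfolding Z_def by blast
      then have "e = fst h" using far_other[OF e, of h] h(3) by (auto simp: base_def split: if_splits)
      then have "base (e, b) = v \<or> base (e, \<not> b) = v" using h(2) by (auto simp: base_def split: if_splits)
      then show False using False b(1) unfolding Z_def by blast
    qed
  qed
  then have "V \<inter> Z = {}" using tree_connected[of Z] assms(1) unfolding Z_def by blast
  then show thesis using that assms unfolding Z_def by blast
qed

text \<open>No tree edge crosses the intersection of two far sides at \<open>v\<close>: the edge of
  \<open>h\<close> starts at \<open>v\<close>, which is outside both, and so its other end is
  outside the far side of \<open>h'\<close>. As the intersection misses \<open>v\<close>, it cannot
  contain \<open>w\<close>.\<close>

lemma far_unique:
  assumes "v \<in> V" "w \<in> V" "fst h \<in> F" "fst h' \<in> F" "base h = v" "base h' = v" "w \<in> far h" "w \<in> far h'"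
  shows "h = h'"
proof (rule ccontr)
  assume ne: "h \<noteq> h'"
  have fne: "fst h \<noteq> fst h'"
  proof
    assume "fst h = fst h'"
    then have "snd h \<noteq> snd h'" using ne by (simp add: prod_eq_iff)
    then show False using assms \<open>fst h = fst h'\<close> by (auto simp: far_def split: if_splits)
  qed
  have *: "\<not> crosses src tgt e (far h \<inter> far h')" if e: "e \<in> F" for e
  proof -
    have aux: "base (fst k, \<not> snd k) \<notin> far k'" if k: "fst k \<in> F" "base k = v" "v \<notin> far k'" "fst k \<noteq> fst k'" for k k'
      using far_other[OF k(1,4)] k(2,3) by (auto simp: base_def split: if_splits)
    have v: "v \<notin> far h" "v \<notin> far h'" using base_far assms by metis+
    consider "e \<noteq> fst h" "e \<noteq> fst h'" | "e = fst h" | "e = fst h'" by blast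
    then show ?thesis
    proof cases
      case 1 then show ?thesis using far_other[OF e, of h] far_other[OF e, of h'] by (auto simp: crosses_def)
    next
      case 2 then show ?thesis using aux[of h h'] assms v fne by (auto simp: crosses_def base_def split: if_splits)
    next
      case 3 then show ?thesis using aux[of h' h] assms v fne by (auto simp: crosses_def base_def split: if_splits)
    qed
  qed
  have "v \<notin> far h" using base_far assms by metis
  then show False using tree_connected[of "far h \<inter> far h'"] * assms by blast
qed

end

section \<open>The topology of a graph\<close>

locale cell_graph =
  fixes X :: "'a topology" and V :: "'a set" and E :: "'a set set" and \<phi> :: "'a set \<Rightarrow> real \<Rightarrow> 'a"
  assumes hausdorff: "Hausdorff_space X" and conn: "connected_space X"
    and finite_V: "finite V" and finite_E: "finite E"
    and \<phi>_cont: "e \<in> E \<Longrightarrow> continuous_map (top_of_set {0..1}) X (\<phi> e)"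
    and \<phi>_bij: "e \<in> E \<Longrightarrow> bij_betw (\<phi> e) {0<..<1} e"
    and \<phi>_ends: "e \<in> E \<Longrightarrow> \<phi> e 0 \<in> V" "e \<in> E \<Longrightarrow> \<phi> e 1 \<in> V"
    and cover: "topspace X = V \<union> \<Union>E" and V_disj: "V \<inter> \<Union>E = {}" and E_disj: "pairwise disjnt E"
begin

lemma \<phi>_mem: "e \<in> E \<Longrightarrow> 0 < r \<Longrightarrow> r < 1 \<Longrightarrow> \<phi> e r \<in> e"
  using \<phi>_bij[of e] by (auto simp: bij_betw_def)

lemma \<phi>_notin_V: "e \<in> E \<Longrightarrow> 0 < r \<Longrightarrow> r < 1 \<Longrightarrow> \<phi> e r \<notin> V"
  using \<phi>_mem V_disj by blast

lemma \<phi>_in_X: "e \<in> E \<Longrightarrow> r \<in> {0..1} \<Longrightarrow> \<phi> e r \<in> topspace X"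
  using continuous_map_image_subset_topspace[OF \<phi>_cont] by force

text \<open>Injectivity fails at the ends of edges, where loops close up and edges meet; but an
  interior point is never a vertex, so one interior parameter suffices.\<close>

lemma \<phi>_eq:
  assumes "e \<in> E" "e' \<in> E" "0 < r" "r < 1" "0 \<le> r'" "r' \<le> 1"
  shows "\<phi> e r = \<phi> e' r' \<longleftrightarrow> e = e' \<and> r = r'"
proof
  assume eq: "\<phi> e r = \<phi> e' r'"
  have 1: "\<phi> e' r' \<notin> V" using \<phi>_notin_V assms eq by metis
  then have "0 < r' \<and> r' < 1" using \<phi>_ends[OF assms(2)] assms by (metis less_eq_real_def)
  then have "\<phi> e r \<in> e" "\<phi> e r \<in> e'" using \<phi>_mem assms eq by metis+
  then have "e = e'" using E_disj assms by (meson disjnt_iff pairwiseD)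
  moreover have "inj_on (\<phi> e) {0<..<1}" using \<phi>_bij assms by (auto simp: bij_betw_def)
  ultimately show "e = e' \<and> r = r'"
    using eq assms \<open>0 < r' \<and> r' < 1\<close> by (auto dest: inj_onD)
qed simp

lemma X_cases:
  assumes "y \<in> topspace X"
  obtains "y \<in> V" | e r where "e \<in> E" "0 < r" "r < 1" "y = \<phi> e r"
proof (cases "y \<in> V")
  case False
  then obtain e where "e \<in> E" "y \<in> e" using assms cover by blast
  then have "y \<in> \<phi> e ` {0<..<1}" using \<phi>_bij by (auto simp: bij_betw_def)
  then show thesis using that \<open>e \<in> E\<close> by auto
qed (use that in blast)

lemma closed_arc:
  assumes "e \<in> E" "0 \<le> a" "b \<le> 1"
  shows "closedin X (\<phi> e ` {a..b})"
proof -
  have "compactin (top_of_set {0..1}) {a..b}"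
    using assms by (auto simp: compactin_subtopology)
  then show ?thesis
    using image_compactin[OF _ \<phi>_cont[OF assms(1)]] compactin_imp_closedin[OF hausdorff] by blast
qed

text \<open>The complement consists of finitely many vertices and finitely many compact images of
  closed parts of the unit interval, all closed in a Hausdorff space. Hence openness can be tested
  edge by edge.\<close>

lemma openin_graph:
  assumes "U \<subseteq> topspace X"
    and "\<And>e. e \<in> E \<Longrightarrow> openin (top_of_set {0..1}) {r \<in> {0..1}. \<phi> e r \<in> U}"
  shows "openin X U"
proof -
  let ?C = "topspace X - U"
  have cl: "closedin X (\<phi> e ` {r \<in> {0..1}. \<phi> e r \<in> ?C})" if e: "e \<in> E" for e
  proof -
    have "closedin (top_of_set {0..1::real}) ({0..1} - {r \<in> {0..1}. \<phi> e r \<in> U})"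
      using assms(2)[OF e] by (auto simp: closedin_def Diff_Diff_Int Int_absorb1)
    moreover have "{0..1} - {r \<in> {0..1}. \<phi> e r \<in> U} = {r \<in> {0..1}. \<phi> e r \<in> ?C}"
      using \<phi>_in_X[OF e] by auto
    ultimately have "closedin (top_of_set {0..1}) {r \<in> {0..1}. \<phi> e r \<in> ?C}" by simp
    then have "compactin (top_of_set {0..1}) {r \<in> {0..1}. \<phi> e r \<in> ?C}"
      by (intro closedin_compact_space) (simp_all add: compact_space_subtopology)
    then show ?thesis
      using image_compactin[OF _ \<phi>_cont[OF e]] compactin_imp_closedin[OF hausdorff] by blast
  qed
  have c1: "closedin X (?C \<inter> V)"
    using closedin_Hausdorff_finite[OF hausdorff, of "?C \<inter> V"] finite_V by auto
  have c2: "closedin X (\<Union>e\<in>E. \<phi> e ` {r \<in> {0..1}. \<phi> e r \<in> ?C})"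
    using cl finite_E by (intro closedin_Union) auto
  have "?C = (?C \<inter> V) \<union> (\<Union>e\<in>E. \<phi> e ` {r \<in> {0..1}. \<phi> e r \<in> ?C})"
  proof
    show "?C \<subseteq> (?C \<inter> V) \<union> (\<Union>e\<in>E. \<phi> e ` {r \<in> {0..1}. \<phi> e r \<in> ?C})"
    proof
      fix y assume y: "y \<in> ?C"
      then have "y \<in> topspace X" by blast
      then show "y \<in> (?C \<inter> V) \<union> (\<Union>e\<in>E. \<phi> e ` {r \<in> {0..1}. \<phi> e r \<in> ?C})"
      proof (cases rule: X_cases)
        case (2 e r)
        then have "y \<in> \<phi> e ` {r \<in> {0..1}. \<phi> e r \<in> ?C}" using y by (intro image_eqI[of _ _ r]) auto
        then show ?thesis using 2(1) by blast
      qed (use y in blast)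
    qed
  qed auto
  then have "closedin X ?C" by (rule ssubst[where P = "closedin X"]) (rule closedin_Un[OF c1 c2])
  then show ?thesis using assms(1) by (simp add: closedin_def Diff_Diff_Int Int_absorb1)
qed

lemma openin_\<phi>_vimage:
  assumes "openin X U" "e \<in> E"
  shows "openin (top_of_set {0..1}) {r \<in> {0..1}. \<phi> e r \<in> U}"
  using openin_continuous_map_preimage[OF \<phi>_cont[OF assms(2)] assms(1)] by simp

lemma continuous_map_graph_real:
  fixes g :: "'a \<Rightarrow> real"
  assumes "openin X T"
    and "\<And>e. e \<in> E \<Longrightarrow> continuous_on {r \<in> {0..1}. \<phi> e r \<in> T} (\<lambda>r. g (\<phi> e r))"
  shows "continuous_map (subtopology X T) euclideanreal g"
proof -
  have TX: "T \<subseteq> topspace X" using assms(1) by (rule openin_subset)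
  have "openin (subtopology X T) {y \<in> T. g y \<in> S}" if "open S" for S
  proof -
    have "openin X {y \<in> T. g y \<in> S}"
    proof (rule openin_graph)
      fix e assume e: "e \<in> E"
      have "openin (top_of_set {r \<in> {0..1}. \<phi> e r \<in> T})
          ({r \<in> {0..1}. \<phi> e r \<in> T} \<inter> (\<lambda>r. g (\<phi> e r)) -` S)"
        using assms(2)[OF e] that by (simp add: continuous_openin_preimage_gen)
      moreover have "{r \<in> {0..1}. \<phi> e r \<in> T} \<inter> (\<lambda>r. g (\<phi> e r)) -` S = {r \<in> {0..1}. \<phi> e r \<in> {y \<in> T. g y \<in> S}}"
        by auto
      ultimately show "openin (top_of_set {0..1}) {r \<in> {0..1}. \<phi> e r \<in> {y \<in> T. g y \<in> S}}"
        using openin_trans[OF _ openin_\<phi>_vimage[OF assms(1) e]] by simp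
    qed (use TX in blast)
    then show ?thesis using openin_subset by (auto simp: openin_subtopology intro!: exI[of _ "{y \<in> T. g y \<in> S}"])
  qed
  then show ?thesis using TX unfolding continuous_map
    by (auto simp: Int_absorb1)
qed

lemma open_arc:
  assumes "e \<in> E" "0 \<le> a" "b \<le> 1"
  shows "openin X (\<phi> e ` {a<..<b})"
proof (rule openin_graph)
  show "\<phi> e ` {a<..<b} \<subseteq> topspace X" using \<phi>_in_X assms by force
  fix e' assume e': "e' \<in> E"
  have "{r \<in> {0..1}. \<phi> e' r \<in> \<phi> e ` {a<..<b}} = (if e' = e then {0..1} \<inter> {a<..<b} else {})"
  proof (intro set_eqI iffI)
    fix r assume "r \<in> {r \<in> {0..1}. \<phi> e' r \<in> \<phi> e ` {a<..<b}}"
    then obtain q where q: "a < q" "q < b" "\<phi> e q = \<phi> e' r" "0 \<le> r" "r \<le> 1" by auto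
    then have "e = e' \<and> q = r" using \<phi>_eq[OF assms(1) e', of q r] assms by auto
    then show "r \<in> (if e' = e then {0..1} \<inter> {a<..<b} else {})" using q by auto
  qed (auto split: if_splits)
  moreover have "openin (top_of_set {0..1}) ({0..1::real} \<inter> {a<..<b})"
    by (intro openin_open_Int) simp
  ultimately show "openin (top_of_set {0..1}) {r \<in> {0..1}. \<phi> e' r \<in> \<phi> e ` {a<..<b}}" by simp
qed

abbreviation src :: "'a set \<Rightarrow> 'a" where "src e \<equiv> \<phi> e 0"
abbreviation tgt :: "'a set \<Rightarrow> 'a" where "tgt e \<equiv> \<phi> e 1"

text \<open>An uncrossed vertex set together with its open edges would be open, and so would the
  rest, built in the same way from the remaining vertices; this splits a connected space.\<close>

lemma crossing_edge:
  assumes "A \<subseteq> V" "A \<noteq> {}" "A \<noteq> V"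
  shows "\<exists>e\<in>E. crosses src tgt e A"
proof (rule ccontr)
  assume "\<not> ?thesis"
  then have nc: "src e \<in> A \<longleftrightarrow> tgt e \<in> A" if "e \<in> E" for e using that by (auto simp: crosses_def)
  define U where "U A = A \<union> \<Union>{e \<in> E. src e \<in> A}" for A
  have op: "openin X (U B)" if B: "B \<subseteq> V" "\<And>e. e \<in> E \<Longrightarrow> src e \<in> B \<longleftrightarrow> tgt e \<in> B" for B
  proof (rule openin_graph)
    show "U B \<subseteq> topspace X" using cover B by (auto simp: U_def)
    fix e assume e: "e \<in> E"
    have "{r \<in> {0..1}. \<phi> e r \<in> U B} = (if src e \<in> B then {0..1} else {})"
    proof -
      have "\<phi> e r \<in> U B \<longleftrightarrow> src e \<in> B" if r: "r \<in> {0..1}" for r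
      proof (cases "r = 0 \<or> r = 1")
        case True
        then have "\<phi> e r \<in> V" "\<phi> e r \<in> B \<longleftrightarrow> src e \<in> B" using \<phi>_ends[OF e] B(2)[OF e] by auto
        then show ?thesis using V_disj by (auto simp: U_def)
      next
        case False
        then have m: "\<phi> e r \<in> e" using \<phi>_mem[OF e] r by auto
        then have "\<phi> e r \<notin> B" using B V_disj e by auto
        moreover have "e' = e" if "e' \<in> E" "\<phi> e r \<in> e'" for e'
          using E_disj that m e by (meson disjnt_iff pairwiseD)
        ultimately show ?thesis using m e by (auto simp: U_def)
      qed
      then show ?thesis by auto
    qed
    then show "openin (top_of_set {0..1}) {r \<in> {0..1}. \<phi> e r \<in> U B}" by simp
  qed
  have "openin X (U A)" using op assms(1) nc by blast
  moreover have "openin X (U (V - A))" using op[of "V - A"] nc \<phi>_ends by blast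
  moreover have "topspace X \<subseteq> U A \<union> U (V - A)"
    using \<phi>_ends cover by (auto simp: U_def)
  moreover have "U A \<inter> U (V - A) = {}"
  proof -
    have "e = e'" if "e \<in> E" "e' \<in> E" "x \<in> e" "x \<in> e'" for e e' x
      using E_disj that by (meson disjnt_iff pairwiseD)
    then show ?thesis using V_disj assms(1) by (auto simp: U_def)
  qed
  moreover have "U A \<noteq> {}" "U (V - A) \<noteq> {}" using assms by (auto simp: U_def)
  ultimately show False using conn unfolding connected_space_def by blast
qed

text \<open>The parameters for which \<open>g\<close> lies in the gap form a clopen set, even if the
  walls move: since \<open>g\<close> avoids the walls, being outside the open gap means being
  outside the closed arc, and both are open conditions.\<close>

lemma trapped_in_arc:
  fixes Z :: "'z topology"
  assumes Z: "connected_space Z" and g: "continuous_map Z X g"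
    and ab: "continuous_map Z euclideanreal a" "continuous_map Z euclideanreal b"
    and e: "e \<in> E"
    and pos: "\<And>z. z \<in> topspace Z \<Longrightarrow> 0 < a z \<and> a z < b z \<and> b z < 1"
    and avoid: "\<And>z. z \<in> topspace Z \<Longrightarrow> g z \<noteq> \<phi> e (a z) \<and> g z \<noteq> \<phi> e (b z)"
    and y: "y \<in> topspace Z" "g y \<in> \<phi> e ` {a y<..<b y}"
    and z: "z \<in> topspace Z"
  shows "g z \<in> \<phi> e ` {a z<..<b z}"
proof -
  let ?P = "{z \<in> topspace Z. g z \<in> \<phi> e ` {a z<..<b z}}"
  have pre: "openin Z {z \<in> topspace Z. g z \<in> U \<and> a z \<in> A \<and> b z \<in> B}"
    if "openin X U" "open A" "open B" for U A B
  proof -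
    have "openin Z ({z \<in> topspace Z. g z \<in> U} \<inter> {z \<in> topspace Z. a z \<in> A} \<inter> {z \<in> topspace Z. b z \<in> B})"
      using that by (intro openin_Int openin_continuous_map_preimage[OF g]
          openin_continuous_map_preimage[OF ab(1)] openin_continuous_map_preimage[OF ab(2)]) simp_all
    moreover have "{z \<in> topspace Z. g z \<in> U} \<inter> {z \<in> topspace Z. a z \<in> A} \<inter> {z \<in> topspace Z. b z \<in> B}
        = {z \<in> topspace Z. g z \<in> U \<and> a z \<in> A \<and> b z \<in> B}" by auto
    ultimately show ?thesis by simp
  qed
  have "openin Z ?P"
  proof (subst openin_subopen, intro ballI)
    fix w assume "w \<in> ?P"
    then obtain q where w: "w \<in> topspace Z" "a w < q" "q < b w" "g w = \<phi> e q" by auto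
    \<comment> \<open>Separating parameters strictly between \<open>g w\<close> and the walls:
      nearby, \<open>g\<close> stays inside \<open>l, u\<close> and the walls stay outside.\<close>
    obtain l u where lu: "a w < l" "l < q" "q < u" "u < b w" using w dense by meson
    note p = pos[OF w(1)]
    let ?N = "{z \<in> topspace Z. g z \<in> \<phi> e ` {l<..<u} \<and> a z \<in> {..<l} \<and> b z \<in> {u<..}}"
    have "openin Z ?N" using open_arc[OF e] lu p by (intro pre) auto
    moreover have "w \<in> ?N" using w lu by auto
    moreover have "?N \<subseteq> ?P" by force
    ultimately show "\<exists>N. openin Z N \<and> w \<in> N \<and> N \<subseteq> ?P" by blast
  qed
  moreover have "openin Z (topspace Z - ?P)"
  proof (subst openin_subopen, intro ballI)
    fix w assume wP: "w \<in> topspace Z - ?P"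
    then have w: "w \<in> topspace Z" by blast
    note p = pos[OF w]
    have nin: "g w \<notin> \<phi> e ` {a w..b w}"
    proof
      assume "g w \<in> \<phi> e ` {a w..b w}"
      then obtain q where q: "a w \<le> q" "q \<le> b w" "g w = \<phi> e q" by auto
      then have "q \<noteq> a w" "q \<noteq> b w" using avoid[OF w] by auto
      then have "g w \<in> \<phi> e ` {a w<..<b w}" using q by auto
      then show False using wP w by blast
    qed
    \<comment> \<open>A slightly larger fixed arc that still misses \<open>g w\<close> will contain
      the gap for all nearby parameters.\<close>
    have "\<exists>l u. 0 < l \<and> l < a w \<and> b w < u \<and> u < 1 \<and> g w \<notin> \<phi> e ` {l..u}"
    proof (cases "g w \<in> \<phi> e ` {0<..<1}")
      case True
      then obtain q where q: "0 < q" "q < 1" "g w = \<phi> e q" by auto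
      then have "q < a w \<or> b w < q" using nin by force
      then obtain l u where lu: "0 < l" "l < a w" "b w < u" "u < 1" "q < l \<or> u < q"
      proof (elim disjE)
        assume "q < a w"
        then obtain l where "q < l" "l < a w" using dense by blast
        moreover obtain u where "b w < u" "u < 1" using p dense by blast
        ultimately show thesis using that[of l u] q by simp
      next
        assume "b w < q"
        then obtain u where "b w < u" "u < q" using dense by blast
        moreover obtain l where "0 < l" "l < a w" using p dense by blast
        ultimately show thesis using that[of l u] q by simp
      qed
      have "g w \<notin> \<phi> e ` {l..u}"
      proof
        assume "g w \<in> \<phi> e ` {l..u}"
        then obtain s where "l \<le> s" "s \<le> u" "\<phi> e q = \<phi> e s" using q by auto
        then show False using \<phi>_eq[OF e e, of q s] q lu by auto
      qed
      then show ?thesis using lu by blast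
    next
      case False
      obtain l where l: "0 < l" "l < a w" using p dense by blast
      obtain u where u: "b w < u" "u < 1" using p dense by blast
      have "{l..u} \<subseteq> {0<..<1}" using l u by auto
      then have "g w \<notin> \<phi> e ` {l..u}" using False by blast
      then show ?thesis using l u by blast
    qed
    then obtain l u where lu: "0 < l" "l < a w" "b w < u" "u < 1" "g w \<notin> \<phi> e ` {l..u}" by blast
    let ?N = "{z \<in> topspace Z. g z \<in> topspace X - \<phi> e ` {l..u} \<and> a z \<in> {l<..} \<and> b z \<in> {..<u}}"
    have "openin X (topspace X - \<phi> e ` {l..u})" using closed_arc[OF e] lu by (simp add: closedin_def)
    then have "openin Z ?N" by (intro pre) auto
    moreover have "w \<in> ?N" using w lu continuous_map_image_subset_topspace[OF g] by auto
    moreover have "?N \<subseteq> topspace Z - ?P" by force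
    ultimately show "\<exists>N. openin Z N \<and> w \<in> N \<and> N \<subseteq> topspace Z - ?P" by blast
  qed
  ultimately have "?P = {} \<or> ?P = topspace Z"
    using Z unfolding connected_space_clopen_in closedin_def by blast
  then show ?thesis using y z by blast
qed

end

section \<open>Fixed-point-free maps of a cut graph\<close>

text \<open>On an occupied edge \<open>[lo e, hi e]\<close> will be the stretch from the first to
  the last label. Removing these stretches leaves a tree with open stubs, one for each half-edge
  outside \<open>F\<close>.\<close>

locale cut_graph =
  cell_graph X V E \<phi> + tree_sides V F "\<lambda>e. \<phi> e 0" "\<lambda>e. \<phi> e 1" side
  for X :: "'a topology" and V E \<phi> F side +
  fixes lo hi :: "'a set \<Rightarrow> real"
  assumes F_E: "F \<subseteq> E" and card_F: "card F + 1 = card V"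
    and lohi: "e \<in> E - F \<Longrightarrow> 0 < lo e \<and> lo e \<le> hi e \<and> hi e < 1"
begin

definition T :: "'a set" where
  "T = topspace X - (\<Union>d\<in>E - F. \<phi> d ` {lo d..hi d})"

definition half :: "'a set \<times> bool \<Rightarrow> real \<Rightarrow> 'a" where
  "half h r = \<phi> (fst h) (if snd h then 1 - r else r)"

text \<open>The length of the half-edge inside \<open>T\<close>; on a tree edge it is measured up to
  the opposite vertex.\<close>

definition reach :: "'a set \<times> bool \<Rightarrow> real" where
  "reach h = (if fst h \<in> F then 1 else if snd h then 1 - hi (fst h) else lo (fst h))"

text \<open>An interpolation between 0 at \<open>v\<close> and 1 at all other vertices. The bump
  \<open>r * (1 - r)\<close> keeps it positive inside an edge even if both ends are
  \<open>v\<close>, as for a loop.\<close>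

definition away :: "'a \<Rightarrow> 'a set \<Rightarrow> real \<Rightarrow> real" where
  "away v e r = (1 - r) * of_bool (src e \<noteq> v) + r * of_bool (tgt e \<noteq> v) + r * (1 - r)"

definition edge_coord :: "'a set \<times> bool \<Rightarrow> 'a set \<Rightarrow> real \<Rightarrow> real" where
  "edge_coord h e r =
    (if e \<in> F then
       if e = fst h then if snd h then 1 - r else r
       else if src e \<in> far h then 1 else - away (base h) e r
     else if r < lo e then if h = (e, False) then r else if src e \<in> far h then 1 else - away (base h) e r
     else if h = (e, True) then 1 - r else if tgt e \<in> far h then 1 else - away (base h) e r)"

text \<open>Signed distance from the base of a half-edge: positive exactly in its direction, and
  zero only at the base.  This makes both fixed points and the value at the base visible as zeros of
  \<open>coord h (g (half h r)) - r\<close>.\<close>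
definition coord :: "'a set \<times> bool \<Rightarrow> 'a \<Rightarrow> real" where
  "coord h y = (if y \<in> V then if y \<in> far h then 1 else - of_bool (y \<noteq> base h)
    else (\<lambda>(e, r). edge_coord h e r) (THE p. fst p \<in> E \<and> 0 < snd p \<and> snd p < 1 \<and> y = \<phi> (fst p) (snd p)))"

lemma T_open: "openin X T"
proof -
  have "closedin X (\<Union>d\<in>E - F. \<phi> d ` {lo d..hi d})"
    using finite_E lohi by (intro closedin_Union) (auto intro!: closed_arc less_imp_le)
  then show ?thesis unfolding T_def by (simp add: openin_diff)
qed

lemma T_X: "T \<subseteq> topspace X" unfolding T_def by blast

lemma \<phi>_T_iff:
  assumes "e \<in> E" "r \<in> {0..1}"
  shows "\<phi> e r \<in> T \<longleftrightarrow> e \<in> F \<or> r < lo e \<or> hi e < r"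
proof -
  have "\<phi> e r \<in> \<phi> d ` {lo d..hi d} \<longleftrightarrow> d = e \<and> lo d \<le> r \<and> r \<le> hi d" if d: "d \<in> E - F" for d
  proof -
    have "\<phi> d q = \<phi> e r \<longleftrightarrow> d = e \<and> q = r" if "q \<in> {lo d..hi d}" for q
      using \<phi>_eq[of d e q r] d lohi[OF d] that assms by auto
    then show ?thesis by force
  qed
  then show ?thesis using assms \<phi>_in_X unfolding T_def by force
qed

lemma V_T: "V \<subseteq> T"
proof
  fix v assume v: "v \<in> V"
  have "v \<notin> \<phi> d ` {lo d..hi d}" if d: "d \<in> E - F" for d
    using \<phi>_notin_V[of d] d lohi[OF d] v by force
  then show "v \<in> T" using v cover unfolding T_def by blast
qed

lemma base_half: "half h 0 = base h"
  by (simp add: half_def base_def)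

lemma base_V: "fst h \<in> E \<Longrightarrow> base h \<in> V"
  using \<phi>_ends by (simp add: base_def)

lemma reach_bounds: "fst h \<in> E \<Longrightarrow> 0 < reach h \<and> reach h \<le> 1"
  using lohi[of "fst h"] by (auto simp: reach_def)

lemma half_T: "fst h \<in> E \<Longrightarrow> 0 \<le> r \<Longrightarrow> r < reach h \<Longrightarrow> half h r \<in> T"
  using \<phi>_T_iff[of "fst h" "if snd h then 1 - r else r"] reach_bounds[of h]
  by (auto simp: half_def reach_def split: if_splits)

lemma half_continuous:
  assumes "fst h \<in> E"
  shows "continuous_map (top_of_set {0..<reach h}) (subtopology X T) (half h)"
proof -
  have "continuous_map (top_of_set {0..<reach h}) (top_of_set {0..1}) (\<lambda>r. if snd h then 1 - r else r)"
    using reach_bounds[OF assms] by (auto simp: continuous_map_in_subtopology intro!: continuous_intros)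
  from continuous_map_compose[OF this \<phi>_cont[OF assms]]
  have "continuous_map (top_of_set {0..<reach h}) X (half h)"
    by (simp add: half_def[abs_def] comp_def)
  then show ?thesis using half_T[OF assms] by (auto simp: continuous_map_in_subtopology)
qed

lemma coord_vertex: "v \<in> V \<Longrightarrow> coord h v = (if v \<in> far h then 1 else - of_bool (v \<noteq> base h))"
  by (simp add: coord_def)

text \<open>The point is the agreement of the edge formula and the vertex formula at the ends of an
  edge, which makes \<open>coord\<close> continuous across vertices.\<close>

lemma coord_\<phi>:
  assumes "e \<in> E" "r \<in> {0..1}" "fst h \<in> E"
  shows "coord h (\<phi> e r) = edge_coord h e r"
proof (cases "r = 0 \<or> r = 1")
  case True
  have cv: "coord h (\<phi> e r) = (if \<phi> e r \<in> far h then 1 else - of_bool (\<phi> e r \<noteq> base h))"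
    using \<phi>_ends assms True by (intro coord_vertex) auto
  have aw: "away (base h) e r = of_bool (\<phi> e r \<noteq> base h)" using True by (auto simp: away_def)
  show ?thesis
  proof (cases "e = fst h")
    case eh: True
    show ?thesis
    proof (cases "e \<in> F")
      case eF: True
      have "base (e, \<not> snd h) \<in> far h" using far_opposite[of h] eh eF by simp
      moreover have "base h \<notin> far h" by (rule base_far)
      moreover have "base h = \<phi> e (if snd h then 1 else 0)" "base (e, \<not> snd h) = \<phi> e (if snd h then 0 else 1)"
        using eh by (simp_all add: base_def)
      ultimately show ?thesis using cv True eF eh by (cases "snd h") (auto simp: edge_coord_def)
    next
      case False
      then have "far h = {}" "base h = \<phi> e (if snd h then 1 else 0)" using eh by (simp_all add: far_def base_def)
      moreover have "0 < lo e" "lo e < 1" using lohi[of e] assms False by auto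
      ultimately show ?thesis using cv True False eh aw by (cases h; cases "snd h") (auto simp: edge_coord_def)
    qed
  next
    case False
    have "0 < lo e" "lo e < 1" if "e \<notin> F" using lohi[of e] assms that by auto
    then show ?thesis using cv True False aw far_other[of e h]
      by (cases "e \<in> F"; cases h) (auto simp: edge_coord_def)
  qed
next
  case False
  then have r: "0 < r" "r < 1" using assms by auto
  have "(THE p. fst p \<in> E \<and> 0 < snd p \<and> snd p < 1 \<and> \<phi> e r = \<phi> (fst p) (snd p)) = (e, r)"
    using r assms \<phi>_eq[of e] by (intro the_equality) (auto simp: prod_eq_iff)
  then show ?thesis using \<phi>_notin_V[OF assms(1) r] by (simp add: coord_def)
qed

lemma T_cases:
  assumes "y \<in> T"
  obtains "y \<in> V" | e r where "e \<in> F" "0 < r" "r < 1" "y = \<phi> e r"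
    | e r where "e \<in> E - F" "0 < r" "r < lo e" "y = \<phi> e r" | e r where "e \<in> E - F" "hi e < r" "r < 1" "y = \<phi> e r"
proof (cases "y \<in> V")
  case False
  then obtain e r where er: "e \<in> E" "0 < r" "r < 1" "y = \<phi> e r" using assms T_X X_cases[of y] by blast
  then have "e \<in> F \<or> r < lo e \<or> hi e < r" using \<phi>_T_iff[of e r] assms by auto
  then show thesis using that(2-4)[of e r] er by blast
qed (use that in blast)

lemma away_pos: "0 < r \<Longrightarrow> r < 1 \<Longrightarrow> 0 < away v e r"
  unfolding away_def by (intro add_nonneg_pos) auto

lemma away_continuous: "continuous_on S (away v e)"
  unfolding away_def by (intro continuous_intros)

lemma coord_continuous:
  assumes h: "fst h \<in> E"
  shows "continuous_map (subtopology X T) euclideanreal (coord h)"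
proof (rule continuous_map_graph_real[OF T_open])
  fix e assume e: "e \<in> E"
  let ?P = "{r \<in> {0..1}. \<phi> e r \<in> T}"
  have "continuous_on ?P (edge_coord h e)"
  proof (cases "e \<in> F")
    case True
    then show ?thesis unfolding edge_coord_def
      by (cases "e = fst h"; cases "snd h"; cases "src e \<in> far h")
        (auto intro!: continuous_intros away_continuous)
  next
    case False
    then have l: "0 < lo e" "lo e \<le> hi e" "hi e < 1" using lohi[of e] e by auto
    have P: "?P = {0..<lo e} \<union> {hi e<..1}" using \<phi>_T_iff[OF e] False l by auto
    have "continuous_on {0..<lo e} (edge_coord h e)"
    proof -
      have "continuous_on {0..<lo e} (\<lambda>r. if h = (e, False) then r else if src e \<in> far h then 1 else - away (base h) e r)"
        by (cases "h = (e, False)"; cases "src e \<in> far h") (auto intro!: continuous_intros away_continuous)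
      then show ?thesis by (rule continuous_on_eq) (use False in \<open>auto simp: edge_coord_def\<close>)
    qed
    moreover have "continuous_on {hi e<..1} (edge_coord h e)"
    proof -
      have "continuous_on {hi e<..1} (\<lambda>r. if h = (e, True) then 1 - r else if tgt e \<in> far h then 1 else - away (base h) e r)"
        by (cases "h = (e, True)"; cases "tgt e \<in> far h") (auto intro!: continuous_intros away_continuous)
      then show ?thesis by (rule continuous_on_eq) (use False l in \<open>auto simp: edge_coord_def\<close>)
    qed
    moreover have "openin (top_of_set ({0..<lo e} \<union> {hi e<..1})) {0..<lo e}"
      using l by (auto simp: openin_open intro!: exI[of _ "{..<lo e}"])
    moreover have "openin (top_of_set ({0..<lo e} \<union> {hi e<..1})) {hi e<..1}"
      using l by (auto simp: openin_open intro!: exI[of _ "{hi e<..}"])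
    ultimately show ?thesis unfolding P by (intro continuous_on_Un_local_open)
  qed
  then show "continuous_on ?P (\<lambda>r. coord h (\<phi> e r))"
    by (rule continuous_on_eq) (use coord_\<phi>[OF e _ h] in auto)
qed

lemma coord_half:
  assumes "fst h \<in> E" "0 \<le> r" "r < reach h"
  shows "coord h (half h r) = r"
proof -
  have "(if snd h then 1 - r else r) \<in> {0..1}" using reach_bounds[OF assms(1)] assms by auto
  then have "coord h (half h r) = edge_coord h (fst h) (if snd h then 1 - r else r)"
    unfolding half_def using coord_\<phi> assms(1) by blast
  also have "\<dots> = r"
    using assms lohi[of "fst h"] by (cases h) (auto simp: edge_coord_def reach_def split: if_splits)
  finally show ?thesis .
qed

lemma coord_cases:
  assumes h: "fst h \<in> E" and y: "y \<in> T"
  obtains r where "0 < r" "r < reach h" "y = half h r" "coord h y = r" | "y = base h" "coord h y = 0"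
    | "coord h y < 0" | "fst h \<in> F" "coord h y = 1"
proof -
  have fd: "far h = {}" if "fst h \<notin> F" using that by (simp add: far_def)
  show thesis using y
  proof (cases rule: T_cases)
    case 1
    then show thesis using that(2-4) coord_vertex[of y h] fd
      by (cases "y \<in> far h"; cases "y = base h") auto
  next
    case (2 e r)
    then have c: "coord h y = edge_coord h e r" using coord_\<phi>[of e r h] F_E h by auto
    show thesis
    proof (cases "e = fst h")
      case True
      show thesis
        by (rule that(1)[of "if snd h then 1 - r else r"]) (use 2 True c in \<open>auto simp: reach_def half_def edge_coord_def\<close>)
    next
      case False
      then show thesis using that(3,4) c 2 fd away_pos[of r "base h" e]
        by (cases "src e \<in> far h") (auto simp: edge_coord_def)
    qed
  next
    case (3 e r)
    then have l: "lo e \<le> hi e" "hi e < 1" using lohi[of e] by auto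
    then have c: "coord h y = edge_coord h e r" using coord_\<phi>[of e r h] h 3 by auto
    show thesis
    proof (cases "h = (e, False)")
      case True
      show thesis by (rule that(1)[of r]) (use 3 True c in \<open>auto simp: reach_def half_def edge_coord_def\<close>)
    next
      case False
      then show thesis using that(3,4) c 3 l fd away_pos[of r "base h" e]
        by (cases "src e \<in> far h") (auto simp: edge_coord_def)
    qed
  next
    case (4 e r)
    then have l: "0 < lo e" "lo e \<le> hi e" "hi e < 1" using lohi[of e] by auto
    then have c: "coord h y = edge_coord h e r" using coord_\<phi>[of e r h] h 4 by auto
    show thesis
    proof (cases "h = (e, True)")
      case True
      show thesis by (rule that(1)[of "1 - r"]) (use 4 l True c in \<open>auto simp: reach_def half_def edge_coord_def\<close>)
    next
      case False
      then show thesis using that(3,4) c 4 l fd away_pos[of r "base h" e]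
        by (cases "tgt e \<in> far h") (auto simp: edge_coord_def)
    qed
  qed
qed

lemma ex1_far:
  assumes "v \<in> V" "w \<in> V" "v \<noteq> w"
  shows "\<exists>!h. fst h \<in> E \<and> base h = v \<and> w \<in> far h"
proof -
  have F: "fst h \<in> F" if "w \<in> far h" for h using that by (auto simp: far_def split: if_splits)
  obtain h where "fst h \<in> F" "base h = v" "w \<in> far h" using ex_far[OF assms] by blast
  then show ?thesis using far_unique[OF assms(1,2)] F F_E by (intro ex1I[of _ h]) blast+
qed

text \<open>If \<open>y\<close> lies on a tree edge or stub at \<open>v\<close>, that half-edge is
  the only direction (\<open>own\<close>). Otherwise \<open>y\<close> is seen from \<open>v\<close>
  in the same directions as some vertex \<open>w\<close>, for which the tree gives existence and
  uniqueness (\<open>near\<close>).\<close>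

lemma ex1_direction:
  assumes v: "v \<in> V" and y: "y \<in> T" and ne: "y \<noteq> v"
  shows "\<exists>!h. fst h \<in> E \<and> base h = v \<and> 0 < coord h y"
proof -
  have own: ?thesis if k: "fst k \<in> E" "base k = v" "0 < coord k y"
      "\<And>h. fst h \<in> E \<Longrightarrow> base h = v \<Longrightarrow> 0 < coord h y \<Longrightarrow> h = k" for k
  proof (rule ex1I[of _ k])
    show "fst k \<in> E \<and> base k = v \<and> 0 < coord k y" using k(1-3) by simp
    show "h = k" if "fst h \<in> E \<and> base h = v \<and> 0 < coord h y" for h
      using that by (intro k(4)) simp_all
  qed
  have near: ?thesis if "w \<in> V" "w \<noteq> v" "\<And>h. fst h \<in> E \<Longrightarrow> base h = v \<Longrightarrow> 0 < coord h y \<longleftrightarrow> w \<in> far h" for w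
  proof -
    have "(fst h \<in> E \<and> base h = v \<and> 0 < coord h y) \<longleftrightarrow> (fst h \<in> E \<and> base h = v \<and> w \<in> far h)" for h
      using that(3) by blast
    then show ?thesis using ex1_far[OF v that(1)] that(2) by simp
  qed
  show ?thesis using y
  proof (cases rule: T_cases)
    case 1
    then show ?thesis by (intro near[of y]) (auto simp: ne coord_vertex)
  next
    case (2 e r)
    have eE: "e \<in> E" using 2 F_E by blast
    have c: "0 < coord h y \<longleftrightarrow> e = fst h \<or> src e \<in> far h" if "fst h \<in> E" for h
      using coord_\<phi>[of e r h] 2 eE that away_pos[of r "base h" e]
      by (cases "e = fst h"; cases "src e \<in> far h"; cases "snd h") (simp_all add: edge_coord_def)
    have "src e \<noteq> tgt e" using side_ends[of e] 2 by metis
    show ?thesis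
    proof (cases "v = src e \<or> v = tgt e")
      case True
      show ?thesis
      proof (rule own[of "(e, v = tgt e)"])
        show "fst (e, v = tgt e) \<in> E" "base (e, v = tgt e) = v" "0 < coord (e, v = tgt e) y"
          using eE True c by (auto simp: base_def)
        fix h assume h: "fst h \<in> E" "base h = v" "0 < coord h y"
        have "fst h = e"
        proof (rule ccontr)
          assume "fst h \<noteq> e"
          then have "src e \<in> far h" "tgt e \<in> far h" using c h far_other[of e h] 2 by auto
          then show False using True base_far[of h] h by auto
        qed
        then show "h = (e, v = tgt e)" using h(2) \<open>src e \<noteq> tgt e\<close>
          by (cases "snd h") (simp_all add: base_def prod_eq_iff)
      qed
    next
      case False
      show ?thesis
      proof (rule near[of "src e"])
        show "0 < coord h y \<longleftrightarrow> src e \<in> far h" if "fst h \<in> E" "base h = v" for h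
          using c[OF that(1)] that False by (auto simp: base_def split: if_splits)
      qed (use False \<phi>_ends eE in auto)
    qed
  next
    case (3 e r)
    then have l: "0 < lo e" "lo e \<le> hi e" "hi e < 1" using lohi[of e] by auto
    have c: "0 < coord h y \<longleftrightarrow> h = (e, False) \<or> src e \<in> far h" if "fst h \<in> E" for h
      using coord_\<phi>[of e r h] 3 l that away_pos[of r "base h" e] by (auto simp: edge_coord_def)
    show ?thesis
    proof (cases "v = src e")
      case True
      show ?thesis
      proof (rule own[of "(e, False)"])
        show "fst (e, False) \<in> E" "base (e, False) = v" "0 < coord (e, False) y"
          using 3 c[of "(e, False)"] True by (simp_all add: base_def)
        show "h = (e, False)" if "fst h \<in> E" "base h = v" "0 < coord h y" for h
          using c[OF that(1)] that base_far[of h] True by simp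
      qed
    next
      case False
      show ?thesis
      proof (rule near[of "src e"])
        show "0 < coord h y \<longleftrightarrow> src e \<in> far h" if "fst h \<in> E" "base h = v" for h
        proof -
          have "h \<noteq> (e, False)" using that(2) False by (auto simp: base_def)
          then show ?thesis using c[OF that(1)] by simp
        qed
      qed (use False 3 \<phi>_ends in auto)
    qed
  next
    case (4 e r)
    then have l: "0 < lo e" "lo e \<le> hi e" "hi e < 1" using lohi[of e] by auto
    have c: "0 < coord h y \<longleftrightarrow> h = (e, True) \<or> tgt e \<in> far h" if "fst h \<in> E" for h
      using coord_\<phi>[of e r h] 4 l that away_pos[of r "base h" e] by (auto simp: edge_coord_def)
    show ?thesis
    proof (cases "v = tgt e")
      case True
      show ?thesis
      proof (rule own[of "(e, True)"])
        show "fst (e, True) \<in> E" "base (e, True) = v" "0 < coord (e, True) y"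
          using 4 c[of "(e, True)"] True by (simp_all add: base_def)
        show "h = (e, True)" if "fst h \<in> E" "base h = v" "0 < coord h y" for h
          using c[OF that(1)] that base_far[of h] True by simp
      qed
    next
      case False
      show ?thesis
      proof (rule near[of "tgt e"])
        show "0 < coord h y \<longleftrightarrow> tgt e \<in> far h" if "fst h \<in> E" "base h = v" for h
        proof -
          have "h \<noteq> (e, True)" using that(2) False by (auto simp: base_def)
          then show ?thesis using c[OF that(1)] by simp
        qed
      qed (use False 4 \<phi>_ends in auto)
    qed
  qed
qed

text \<open>The midpoint has coordinate \<open>1/2\<close> from both ends, so this threshold tells
  on which side of it \<open>y\<close> lies; off the edge one coordinate is 1 and the other is not
  positive.\<close>

lemma coord_opposite:
  assumes e: "e \<in> F" and y: "y \<in> T" "y \<noteq> \<phi> e (1/2)"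
  shows "1/2 < coord (e, True) y \<longleftrightarrow> \<not> 1/2 < coord (e, False) y"
proof -
  have far: "w \<in> far (e, True) \<longleftrightarrow> w \<notin> far (e, False)" for w using e by (simp add: far_def)
  have E: "fst (e, b) \<in> E" for b using e F_E by auto
  show ?thesis using y(1)
  proof (cases rule: T_cases)
    case 1
    then show ?thesis using far[of y] coord_vertex[of y] by auto
  next
    case (2 e' r)
    then have c: "coord (e, b) y = edge_coord (e, b) e' r" for b using coord_\<phi>[OF _ _ E] F_E by auto
    show ?thesis
    proof (cases "e' = e")
      case True
      have "r \<noteq> 1/2"
      proof
        assume r: "r = 1/2"
        show False using y(2) unfolding 2(4) True r by blast
      qed
      then show ?thesis using c 2 True by (auto simp: edge_coord_def)
    next
      case False
      have "1/2 < coord (e, b) y \<longleftrightarrow> src e' \<in> far (e, b)" for b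
        using c[of b] 2 False away_pos[of r "base (e, b)" e']
        by (cases "src e' \<in> far (e, b)") (simp_all add: edge_coord_def)
      then show ?thesis using far by simp
    qed
  next
    case (3 e' r)
    then have l: "0 < lo e'" "lo e' \<le> hi e'" "hi e' < 1" using lohi[of e'] by auto
    then have c: "coord (e, b) y = edge_coord (e, b) e' r" for b using coord_\<phi>[OF _ _ E] 3 by auto
    have "e' \<noteq> e" using e 3 by blast
    then have "1/2 < coord (e, b) y \<longleftrightarrow> src e' \<in> far (e, b)" for b
      using c[of b] 3 l away_pos[of r "base (e, b)" e']
      by (cases "src e' \<in> far (e, b)") (simp_all add: edge_coord_def)
    then show ?thesis using far by simp
  next
    case (4 e' r)
    then have l: "0 < lo e'" "lo e' \<le> hi e'" "hi e' < 1" using lohi[of e'] by auto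
    then have c: "coord (e, b) y = edge_coord (e, b) e' r" for b using coord_\<phi>[OF _ _ E] 4 by auto
    have "e' \<noteq> e" using e 4 by blast
    then have "1/2 < coord (e, b) y \<longleftrightarrow> tgt e' \<in> far (e, b)" for b
      using c[of b] 4 l away_pos[of r "base (e, b)" e']
      by (cases "tgt e' \<in> far (e, b)") (simp_all add: edge_coord_def)
    then show ?thesis using far by simp
  qed
qed

text \<open>Tree edges join all vertices, and every stub hangs on a vertex. Connectedness is what
  keeps \<open>f\<close> trapped between resting labels while one label roams through
  \<open>T\<close>.\<close>

lemma T_connected: "connected_space (subtopology X T)"
proof -
  let ?Y = "subtopology X T"
  have conn_arc: "connected_component_of ?Y (\<phi> e p) (\<phi> e q)"
    if e: "e \<in> E" and pq: "0 \<le> p" "p \<le> q" "q \<le> 1" and T: "\<phi> e ` {p..q} \<subseteq> T" for e p q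
  proof -
    have "connectedin X (\<phi> e ` {p..q})"
      using pq by (intro connectedin_continuous_map_image[OF \<phi>_cont[OF e]])
        (auto simp: connectedin_subtopology connectedin_iff_connected)
    then have "connectedin ?Y (\<phi> e ` {p..q})" using T by (simp add: connectedin_subtopology)
    moreover have "\<phi> e p \<in> \<phi> e ` {p..q}" "\<phi> e q \<in> \<phi> e ` {p..q}" using pq by auto
    ultimately show ?thesis unfolding connected_component_of_def by blast
  qed
  have sym: "connected_component_of ?Y x y \<Longrightarrow> connected_component_of ?Y y x" for x y
    by (simp add: connected_component_of_sym)
  obtain v0 where v0: "v0 \<in> V" using card_F by (metis Suc_eq_plus1 card.empty equals0I nat.distinct(1))
  define A where "A = {v. connected_component_of ?Y v0 v}"
  have A_step: "y \<in> A" if "x \<in> A" "connected_component_of ?Y x y" for x y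
    using connected_component_of_trans[of ?Y v0 x y] that by (simp add: A_def)
  have F_arc: "connected_component_of ?Y (\<phi> e 0) (\<phi> e r)" if "e \<in> F" "0 \<le> r" "r \<le> 1" for e r
    using that F_E \<phi>_T_iff[of e] by (intro conn_arc) auto
  have V_A: "V \<subseteq> A"
  proof (rule ccontr)
    assume "\<not> V \<subseteq> A"
    moreover have "v0 \<in> A" using v0 V_T T_X by (auto simp: A_def connected_component_of_refl)
    ultimately obtain e where e: "e \<in> F" "crosses src tgt e A" using tree_connected[of A] v0 by blast
    have "connected_component_of ?Y (src e) (tgt e)" using F_arc e by simp
    then have "src e \<in> A \<longleftrightarrow> tgt e \<in> A" using A_step[OF _ sym] A_step by metis
    then show False using e by (simp add: crosses_def)
  qed
  have "y \<in> A" if "y \<in> T" for y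
    using that
  proof (cases rule: T_cases)
    case 1 then show ?thesis using V_A by blast
  next
    case (2 e r)
    then have "src e \<in> A" "connected_component_of ?Y (src e) y" using V_A \<phi>_ends F_E F_arc by auto
    then show ?thesis using A_step by simp
  next
    case (3 e r)
    then have l: "0 < lo e" "lo e \<le> hi e" "hi e < 1" using lohi[of e] by auto
    have "connected_component_of ?Y (src e) y" unfolding 3(4)
      using 3 l \<phi>_T_iff[of e] by (intro conn_arc) auto
    moreover have "src e \<in> A" using V_A \<phi>_ends 3 by auto
    ultimately show ?thesis using A_step by simp
  next
    case (4 e r)
    then have l: "0 < lo e" "lo e \<le> hi e" "hi e < 1" using lohi[of e] by auto
    have "connected_component_of ?Y y (tgt e)" unfolding 4(4)
      using 4 l \<phi>_T_iff[of e] by (intro conn_arc) auto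
    moreover have "tgt e \<in> A" using V_A \<phi>_ends 4 by auto
    ultimately show ?thesis using A_step[OF _ sym] by simp
  qed
  then have "connected_component_of ?Y v0 y" if "y \<in> T" for y using that by (simp add: A_def)
  then have "connected_component_of ?Y x y" if "x \<in> T" "y \<in> T" for x y
    using that sym[of v0 x] connected_component_of_trans[of ?Y x v0 y] by simp
  then show ?thesis unfolding connected_space_iff_connected_component by simp
qed

section \<open>Outward half-edges of a fixed-point-free self-map\<close>

context
  fixes g :: "'a \<Rightarrow> 'a"
  assumes g: "continuous_map (subtopology X T) (subtopology X T) g" and g_free: "\<And>y. y \<in> T \<Longrightarrow> g y \<noteq> y"
begin

definition outward :: "'a set \<times> bool \<Rightarrow> bool" where
  "outward h \<longleftrightarrow> 0 < coord h (g (base h))"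

lemma g_T: "y \<in> T \<Longrightarrow> g y \<in> T"
  using g T_X by (auto simp: continuous_map_def)

text \<open>The difference of the two sides has no zero along the half-edge, as a coordinate in
  \<open>{0..<reach h}\<close> determines the point; by the intermediate value theorem its sign at
  the base persists.\<close>

lemma outward_iff:
  assumes h: "fst h \<in> E" and r: "0 \<le> r" "r < reach h"
  shows "outward h \<longleftrightarrow> r < coord h (g (half h r))"
proof -
  let ?p = "\<lambda>r. coord h (g (half h r)) - r"
  have "continuous_map (top_of_set {0..<reach h}) euclideanreal (coord h \<circ> (g \<circ> half h))"
    by (intro continuous_map_compose[OF _ coord_continuous[OF h]] continuous_map_compose[OF half_continuous[OF h] g])
  then have "continuous_on {0..<reach h} (coord h \<circ> (g \<circ> half h))" by simp
  then have cont: "continuous_on {0..<reach h} ?p"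
    by (intro continuous_on_diff) (simp_all add: comp_def)
  have nz: "?p q \<noteq> 0" if q: "0 \<le> q" "q < reach h" for q
  proof
    assume "?p q = 0"
    then have c: "coord h (g (half h q)) = q" by simp
    have T: "half h q \<in> T" using half_T[OF h] q by blast
    have "g (half h q) = half h q"
      using coord_cases[OF h g_T[OF T]] c q base_half[of h] reach_bounds[OF h] by (smt (verit, best))
    then show False using g_free T by blast
  qed
  have "connected (?p ` {0..<reach h})"
    using cont by (intro connected_continuous_image) auto
  moreover have "?p 0 \<in> ?p ` {0..<reach h}" "?p r \<in> ?p ` {0..<reach h}" using r by (intro imageI; simp)+
  moreover have "0 \<notin> ?p ` {0..<reach h}" using nz by auto
  ultimately have "\<not> (?p 0 \<le> 0 \<and> 0 \<le> ?p r)" "\<not> (?p r \<le> 0 \<and> 0 \<le> ?p 0)"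
    by (meson connectedD_interval)+
  then show ?thesis unfolding outward_def base_half[symmetric] by auto
qed

text \<open>Both half-edges can be tested at their common midpoint, which \<open>g\<close> moves to
  exactly one side.\<close>

lemma outward_opposite:
  assumes "e \<in> F"
  shows "outward (e, True) \<longleftrightarrow> \<not> outward (e, False)"
proof -
  have E: "fst (e, b) \<in> E" for b using assms F_E by auto
  have h: "half (e, b) (1/2) = \<phi> e (1/2)" for b by (simp add: half_def)
  have T: "\<phi> e (1/2) \<in> T" using \<phi>_T_iff[of e "1/2"] assms F_E by auto
  have "outward (e, b) \<longleftrightarrow> 1/2 < coord (e, b) (g (\<phi> e (1/2)))" for b
    using outward_iff[OF E, of "1/2" b] assms unfolding h by (simp add: reach_def)
  then show ?thesis using coord_opposite[OF assms g_T[OF T] g_free[OF T]] by simp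
qed

lemma outward_bij: "bij_betw base {h. fst h \<in> E \<and> outward h} V"
proof -
  have ex1: "\<exists>!h. fst h \<in> E \<and> base h = v \<and> 0 < coord h (g v)" if "v \<in> V" for v
    using ex1_direction[OF that g_T g_free] V_T that by blast
  show ?thesis
  proof (rule bij_betwI')
    fix h k assume "h \<in> {h. fst h \<in> E \<and> outward h}" "k \<in> {h. fst h \<in> E \<and> outward h}"
    then show "base h = base k \<longleftrightarrow> h = k"
      using ex1[OF base_V[of h]] unfolding outward_def mem_Collect_eq by metis
  next
    fix v assume "v \<in> V"
    then show "\<exists>h\<in>{h. fst h \<in> E \<and> outward h}. v = base h"
      using ex1[of v] unfolding outward_def by blast
  qed (use base_V in blast)
qed

text \<open>Each vertex has one outward half-edge and each tree edge one outward end, so a single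
  outward half-edge is left over for the open ends.\<close>
lemma ex1_outward_end: "\<exists>!h. fst h \<in> E - F \<and> outward h"
proof -
  let ?H = "{h. fst h \<in> E \<and> outward h}"
  have fH: "finite ?H" using bij_betw_finite[OF outward_bij] finite_V by simp
  have "card ?H = card V" using bij_betw_same_card[OF outward_bij] .
  moreover have "card {h \<in> ?H. fst h \<in> F} = card F"
  proof (rule bij_betw_same_card[of fst], rule bij_betwI')
    fix h k assume "h \<in> {h \<in> ?H. fst h \<in> F}" "k \<in> {h \<in> ?H. fst h \<in> F}"
    then show "fst h = fst k \<longleftrightarrow> h = k"
      using outward_opposite by (cases h; cases k; cases "snd h"; cases "snd k") auto
  next
    fix e assume "e \<in> F"
    then show "\<exists>h\<in>{h \<in> ?H. fst h \<in> F}. e = fst h"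
      using outward_opposite[of e] F_E
      by (intro bexI[of _ "(e, outward (e, True))"]) (cases "outward (e, True)"; auto)+
  qed auto
  moreover have "card ?H = card {h \<in> ?H. fst h \<in> F} + card {h. fst h \<in> E - F \<and> outward h}"
  proof -
    have eq: "?H = {h \<in> ?H. fst h \<in> F} \<union> {h. fst h \<in> E - F \<and> outward h}" using F_E by auto
    have "finite {h \<in> ?H. fst h \<in> F}" "finite {h. fst h \<in> E - F \<and> outward h}"
      by (auto intro: finite_subset[OF _ fH])
    then have "card ({h \<in> ?H. fst h \<in> F} \<union> {h. fst h \<in> E - F \<and> outward h}) =
        card {h \<in> ?H. fst h \<in> F} + card {h. fst h \<in> E - F \<and> outward h}"
      by (rule card_Un_disjoint) auto
    then show ?thesis using arg_cong[OF eq, of card] by simp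
  qed
  ultimately have "card {h. fst h \<in> E - F \<and> outward h} = 1" using card_F by simp
  then obtain h where h: "{h. fst h \<in> E - F \<and> outward h} = {h}" by (rule card_1_singletonE)
  have "k \<in> {h. fst h \<in> E - F \<and> outward h} \<longleftrightarrow> k \<in> {h}" for k by (simp only: h)
  then have iff: "fst k \<in> E - F \<and> outward k \<longleftrightarrow> k = h" for k
    unfolding mem_Collect_eq singleton_iff .
  show ?thesis by (simp only: iff) simp
qed

text \<open>Nothing lies beyond an open end, so a coordinate above \<open>r\<close> forces the image
  onto the same stub, further out. This turns the count of outward ends into a statement on
  gaps.\<close>

lemma outward_end_iff:
  assumes h: "fst h \<in> E - F" and r: "0 < r" "r < reach h"
  shows "outward h \<longleftrightarrow> g (half h r) \<in> half h ` {r<..<reach h}"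
proof -
  have hE: "fst h \<in> E" using h by blast
  have T: "g (half h r) \<in> T" using g_T half_T[OF hE] r by simp
  have "r < coord h (g (half h r)) \<longleftrightarrow> g (half h r) \<in> half h ` {r<..<reach h}"
  proof
    assume "r < coord h (g (half h r))"
    with coord_cases[OF hE T] h r show "g (half h r) \<in> half h ` {r<..<reach h}"
      by (smt (verit) DiffD2 greaterThanLessThan_iff imageI)
  next
    assume "g (half h r) \<in> half h ` {r<..<reach h}"
    then obtain q where "r < q" "q < reach h" "g (half h r) = half h q" by auto
    then show "r < coord h (g (half h r))" using coord_half[OF hE, of q] r by simp
  qed
  then show ?thesis using outward_iff[OF hE, of r] r by simp
qed

end

end

section \<open>Sections of the forgetful map\<close>

lemma affine_combination_less:
  fixes r x y x' y' :: real
  assumes "0 \<le> r" "r \<le> 1" "x < y" "x' < y'"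
  shows "(1 - r) * x + r * x' < (1 - r) * y + r * y'"
proof (cases "r = 0")
  case False
  then have "r * x' < r * y'" using assms by (intro mult_strict_left_mono) auto
  moreover have "(1 - r) * x \<le> (1 - r) * y" using assms by (intro mult_left_mono) auto
  ultimately show ?thesis by linarith
qed (use assms in simp)

locale section_graph =
  cell_graph X V E \<phi> + tree_sides V F "\<lambda>e. \<phi> e 0" "\<lambda>e. \<phi> e 1" side
  for X :: "'a topology" and V E \<phi> F side +
  fixes n :: nat and f :: "(nat \<Rightarrow> 'a) \<Rightarrow> 'a"
  assumes F_E: "F \<subseteq> E" and card_F: "card F + 1 = card V"
    and f_cont: "continuous_map (Conf n X) X f"
    and f_avoid: "x \<in> topspace (Conf n X) \<Longrightarrow> i \<in> {1..n} \<Longrightarrow> f x \<noteq> x i"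
begin

definition realizes :: "('a set \<Rightarrow> nat list) \<Rightarrow> (nat \<Rightarrow> real) \<Rightarrow> bool" where
  "realizes W t \<longleftrightarrow> (\<forall>d. sorted_wrt (\<lambda>k l. t k < t l) (W d)) \<and> (\<forall>d. \<forall>l\<in>set (W d). 0 < t l \<and> t l < 1)"

definition edge_at :: "('a set \<Rightarrow> nat list) \<Rightarrow> nat \<Rightarrow> 'a set" where
  "edge_at W l = (THE d. l \<in> set (W d))"

definition place :: "('a set \<Rightarrow> nat list) \<Rightarrow> (nat \<Rightarrow> real) \<Rightarrow> nat \<Rightarrow> 'a" where
  "place W t = (\<lambda>l\<in>{1..n}. \<phi> (edge_at W l) (t l))"

definition Sel :: "('a set \<Rightarrow> nat list) \<Rightarrow> 'a set \<Rightarrow> nat \<Rightarrow> nat \<Rightarrow> bool" where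
  "Sel W e a b \<longleftrightarrow> arrangement (E - F) {1..n} W \<and> e \<in> E - F \<and> adjacent (W e) a b \<and>
     (\<exists>t. realizes W t \<and> f (place W t) \<in> \<phi> e ` {t a<..<t b})"

lemma edge_at_eq:
  assumes "arrangement D K W" "l \<in> set (W d)"
  shows "edge_at W l = d"
  unfolding edge_at_def
proof (rule the_equality)
  fix d' assume "l \<in> set (W d')"
  then show "d' = d" using assms unfolding arrangement_def by blast
qed fact

lemma edge_at_mem:
  assumes "arrangement D K W" "l \<in> K"
  shows "edge_at W l \<in> D" "l \<in> set (W (edge_at W l))"
proof -
  obtain d where d: "l \<in> set (W d)" using assms unfolding arrangement_def by blast
  then have "d \<in> D" using assms(1) unfolding arrangement_def by force
  then show "edge_at W l \<in> D" "l \<in> set (W (edge_at W l))" using edge_at_eq[OF assms(1) d] d by simp_all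
qed

lemma realizes_less:
  assumes "realizes W t" "i < j" "j < length (W d)"
  shows "t (W d ! i) < t (W d ! j)"
  using assms by (auto simp: realizes_def sorted_wrt_iff_nth_less)

lemma realizes_inj:
  assumes "realizes W t" "k \<in> set (W d)" "l \<in> set (W d)" "t k = t l"
  shows "k = l"
proof -
  obtain i j where ij: "i < length (W d)" "j < length (W d)" "k = W d ! i" "l = W d ! j"
    using assms(2,3) by (metis in_set_conv_nth)
  then show ?thesis using realizes_less[OF assms(1)] assms(4) by (metis less_irrefl linorder_neqE_nat)
qed

lemma realizes_adjacent:
  assumes "realizes W t" "adjacent (W e) a b"
  shows "0 < t a" "t a < t b" "t b < 1" "a \<in> set (W e)" "b \<in> set (W e)"
proof -
  obtain u v where "W e = u @ a # b # v" using assms(2) unfolding adjacent_def by blast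
  moreover have "sorted_wrt (\<lambda>k l. t k < t l) (W e)" "\<forall>l\<in>set (W e). 0 < t l \<and> t l < 1"
    using assms(1) unfolding realizes_def by blast+
  ultimately show "0 < t a" "t a < t b" "t b < 1" "a \<in> set (W e)" "b \<in> set (W e)"
    by (auto simp: sorted_wrt_append)
qed

lemma continuous_map_Conf:
  assumes "\<And>l. l \<in> {1..n} \<Longrightarrow> continuous_map Z X (\<lambda>z. c z l)"
    and "\<And>z. z \<in> topspace Z \<Longrightarrow> c z \<in> extensional {1..n}"
    and "\<And>z i j. z \<in> topspace Z \<Longrightarrow> i \<in> {1..n} \<Longrightarrow> j \<in> {1..n} \<Longrightarrow> i \<noteq> j \<Longrightarrow> c z i \<noteq> c z j"
  shows "continuous_map Z (Conf n X) c"
  unfolding Conf_def continuous_map_in_subtopology continuous_map_componentwise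
  using assms by (auto simp: image_subset_iff)

lemma place_continuous:
  assumes W: "arrangement (E - F) {1..n} W"
    and t: "\<And>z. z \<in> topspace Z \<Longrightarrow> realizes W (t z)"
    and cont: "\<And>l. l \<in> {1..n} \<Longrightarrow> continuous_map Z euclideanreal (\<lambda>z. t z l)"
  shows "continuous_map Z (Conf n X) (\<lambda>z. place W (t z))"
proof (rule continuous_map_Conf)
  have bd: "0 < t z l" "t z l < 1" if "z \<in> topspace Z" "l \<in> {1..n}" for z l
    using edge_at_mem[OF W that(2)] t[OF that(1)] unfolding realizes_def by blast+
  show "continuous_map Z X (\<lambda>z. place W (t z) l)" if l: "l \<in> {1..n}" for l
  proof -
    have e: "edge_at W l \<in> E" using edge_at_mem[OF W l] by blast
    have "continuous_map Z (top_of_set {0..1}) (\<lambda>z. t z l)"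
      using cont[OF l] bd[OF _ l] by (auto simp: continuous_map_in_subtopology less_imp_le)
    from continuous_map_compose[OF this \<phi>_cont[OF e]]
    show ?thesis using l by (simp add: place_def comp_def)
  qed
  show "place W (t z) i \<noteq> place W (t z) j"
    if z: "z \<in> topspace Z" and ij: "i \<in> {1..n}" "j \<in> {1..n}" "i \<noteq> j" for z i j
  proof
    assume eq: "place W (t z) i = place W (t z) j"
    note m = edge_at_mem[OF W ij(1)] edge_at_mem[OF W ij(2)]
    have "edge_at W i = edge_at W j \<and> t z i = t z j"
      using \<phi>_eq[of "edge_at W i" "edge_at W j" "t z i" "t z j"] eq m bd[OF z ij(1)] bd[OF z ij(2)] ij
      by (simp add: place_def)
    then show False using realizes_inj[OF t[OF z], of i "edge_at W i" j] m ij by auto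
  qed
qed (simp add: place_def)

lemma place_in_Conf:
  assumes "arrangement (E - F) {1..n} W" "realizes W t"
  shows "place W t \<in> topspace (Conf n X)"
proof -
  \<comment> \<open>A constant family over a one-point space reduces membership to the continuity
    statement.\<close>
  have "continuous_map (top_of_set {0::real}) (Conf n X) (\<lambda>z. place W t)"
    using assms by (intro place_continuous) auto
  from continuous_map_image_subset_topspace[OF this] show ?thesis by simp
qed

lemma f_place_avoid:
  assumes "arrangement (E - F) {1..n} W" "realizes W t" "l \<in> set (W e)"
  shows "f (place W t) \<noteq> \<phi> e (t l)"
proof -
  have l: "l \<in> {1..n}" using assms(1,3) unfolding arrangement_def by blast
  then show ?thesis
    using f_avoid[OF place_in_Conf[OF assms(1,2)] l] edge_at_eq[OF assms(1,3)] by (simp add: place_def)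
qed

text \<open>The positions realizing \<open>W\<close> form a convex set, so a straight motion leads
  from \<open>t\<close> to \<open>t'\<close>, and \<open>f\<close> cannot leave a gap whose walls
  move along. Hence the existential quantifier in \<open>Sel\<close> is harmless.\<close>

lemma Sel_realizes:
  assumes S: "Sel W e a b" and t': "realizes W t'"
  shows "f (place W t') \<in> \<phi> e ` {t' a<..<t' b}"
proof -
  have W: "arrangement (E - F) {1..n} W" and e: "e \<in> E" and adj: "adjacent (W e) a b"
    using S unfolding Sel_def by blast+
  obtain t where t: "realizes W t" "f (place W t) \<in> \<phi> e ` {t a<..<t b}" using S unfolding Sel_def by blast
  define s where "s r l = (1 - r) * t l + r * t' l" for r :: real and l
  have s: "realizes W (s r)" if r: "r \<in> {0..1}" for r
  proof -
    have mono: "s r k < s r l" if "t k < t l" "t' k < t' l" for k l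
      unfolding s_def using that r by (intro affine_combination_less) auto
    have "0 < s r l \<and> s r l < 1" if "l \<in> set (W d)" for l d
    proof -
      have "0 < t l" "t l < 1" "0 < t' l" "t' l < 1" using t t' that unfolding realizes_def by blast+
      then have "s r l < (1 - r) * 1 + r * 1" "(1 - r) * 0 + r * 0 < s r l" unfolding s_def using r
        by (intro affine_combination_less; simp)+
      then show ?thesis by simp
    qed
    moreover have "sorted_wrt (\<lambda>k l. s r k < s r l) (W d)" for d
      unfolding sorted_wrt_iff_nth_less
      using mono realizes_less[OF t(1)] realizes_less[OF t'] by simp
    ultimately show ?thesis unfolding realizes_def by blast
  qed
  have sc: "continuous_map (top_of_set {0..1}) euclideanreal (\<lambda>r. s r l)" for l
    by (auto simp: s_def intro!: continuous_intros)
  have "f (place W (s 1)) \<in> \<phi> e ` {s 1 a<..<s 1 b}"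
  proof (rule trapped_in_arc[where Z = "top_of_set {0..1}" and y = 0 and g = "\<lambda>r. f (place W (s r))"])
    have "continuous_map (top_of_set {0..1}) (Conf n X) (\<lambda>r. place W (s r))"
      using s sc by (intro place_continuous W) auto
    from continuous_map_compose[OF this f_cont]
    show "continuous_map (top_of_set {0..1}) X (\<lambda>r. f (place W (s r)))" by (simp add: comp_def)
    have "s 0 = t" by (auto simp: s_def)
    then show "f (place W (s 0)) \<in> \<phi> e ` {s 0 a<..<s 0 b}" using t by simp
    show "0 < s r a \<and> s r a < s r b \<and> s r b < 1" if "r \<in> topspace (top_of_set {0..1})" for r
      using realizes_adjacent[OF s adj] that by simp
    show "f (place W (s r)) \<noteq> \<phi> e (s r a) \<and> f (place W (s r)) \<noteq> \<phi> e (s r b)"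
      if "r \<in> topspace (top_of_set {0..1})" for r
      using f_place_avoid[OF W s] realizes_adjacent(4,5)[OF t(1) adj] that by simp
  qed (use sc e in \<open>auto simp: connected_space_subtopology\<close>)
  moreover have "s 1 = t'" by (auto simp: s_def)
  ultimately show ?thesis by simp
qed

text \<open>For one common choice of positions, an interior point of an edge determines edge and
  parameter, and gaps between different neighbours are disjoint.\<close>

lemma Sel_unique:
  assumes S: "Sel W e a b" and S': "Sel W e' a' b'"
  shows "e = e' \<and> a = a' \<and> b = b'"
proof -
  obtain t where t: "realizes W t" using S unfolding Sel_def by blast
  have E: "e \<in> E" "e' \<in> E" and adj: "adjacent (W e) a b" "adjacent (W e') a' b'"
    using S S' unfolding Sel_def by blast+
  note r = realizes_adjacent[OF t adj(1)] realizes_adjacent[OF t adj(2)]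
  obtain q q' where q: "t a < q" "q < t b" "f (place W t) = \<phi> e q"
      "t a' < q'" "q' < t b'" "f (place W t) = \<phi> e' q'"
    using Sel_realizes[OF S t] Sel_realizes[OF S' t] by auto
  have eq: "e = e'" "q = q'" using \<phi>_eq[OF E, of q q'] q r by auto
  obtain u v where uv: "W e = u @ a # b # v" using adj(1) unfolding adjacent_def by blast
  obtain u' v' where uv': "W e = u' @ a' # b' # v'" using adj(2) eq unfolding adjacent_def by blast
  let ?i = "length u" and ?j = "length u'"
  have n: "W e ! ?i = a" "W e ! Suc ?i = b" "Suc ?i < length (W e)"
    using uv by (simp_all add: nth_append)
  have n': "W e ! ?j = a'" "W e ! Suc ?j = b'" "Suc ?j < length (W e)"
    using uv' by (simp_all add: nth_append)
  \<comment> \<open>If one gap began at or after the end of the other, \<open>q\<close> would lie in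
    two disjoint intervals.\<close>
  have "\<not> Suc ?j \<le> ?i" "\<not> Suc ?i \<le> ?j"
    using realizes_less[OF t, of "Suc ?j" ?i e] realizes_less[OF t, of "Suc ?i" ?j e] n n' q eq
    by (auto simp: le_less)
  then have "?i = ?j" by simp
  then show ?thesis using n n' eq by auto
qed

end

section \<open>One label moving among equally spaced ones\<close>

locale mover = section_graph X V E \<phi> F side n f
  for X :: "'a topology" and V E \<phi> F side n f +
  fixes k :: nat and W :: "'a set \<Rightarrow> nat list"
  assumes W: "arrangement (E - F) ({1..n} - {k}) W" and k: "k \<in> {1..n}"
begin

text \<open>The \<open>m\<close> labels on an edge stand at \<open>i / (m + 1)\<close> for
  \<open>i = 1, ..., m\<close>, so \<open>lo\<close> and \<open>hi\<close> are the first and the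
  last position. An empty edge is cut at \<open>1/2\<close>, which keeps the complement
  tree-like.\<close>

definition lo :: "'a set \<Rightarrow> real" where
  "lo d = (if W d = [] then 1/2 else 1 / real (Suc (length (W d))))"

definition hi :: "'a set \<Rightarrow> real" where
  "hi d = (if W d = [] then 1/2 else real (length (W d)) / real (Suc (length (W d))))"

definition t0 :: "nat \<Rightarrow> real" where
  "t0 l = (let d = edge_at W l in
     real (Suc (THE i. i < length (W d) \<and> W d ! i = l)) / real (Suc (length (W d))))"

sublocale cut_graph X V E \<phi> F side lo hi
proof unfold_locales
  show "0 < lo e \<and> lo e \<le> hi e \<and> hi e < 1" for e
    by (cases "W e") (auto simp: lo_def hi_def divide_right_mono)
qed (rule F_E card_F)+

lemma t0_nth: "i < length (W d) \<Longrightarrow> t0 (W d ! i) = real (Suc i) / real (Suc (length (W d)))"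
proof -
  assume i: "i < length (W d)"
  have "distinct (W d)" using W unfolding arrangement_def by blast
  then have "(THE j. j < length (W d) \<and> W d ! j = W d ! i) = i"
    using i by (intro the_equality) (auto simp: nth_eq_iff_index_eq)
  then show ?thesis using edge_at_eq[OF W, of "W d ! i" d] i by (simp add: t0_def Let_def)
qed

lemma W_E: "l \<in> set (W d) \<Longrightarrow> d \<in> E - F"
  using W unfolding arrangement_def by force

lemma W_letter:
  assumes "l \<in> set (W d)" shows "l \<in> {1..n} \<and> l \<noteq> k"
proof -
  have "l \<in> (\<Union>d. set (W d))" using assms by blast
  also have "\<dots> = {1..n} - {k}" using W unfolding arrangement_def by (elim conjE)
  finally show ?thesis by blast
qed

lemma t0_bounds:
  assumes "l \<in> set (W d)" shows "lo d \<le> t0 l" "t0 l \<le> hi d"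
proof -
  obtain i where i: "i < length (W d)" "l = W d ! i" using assms by (metis in_set_conv_nth)
  then show "lo d \<le> t0 l" "t0 l \<le> hi d"
    unfolding i(2) t0_nth[OF i(1)] lo_def hi_def by (auto intro!: divide_right_mono)
qed

lemma t0_ends:
  assumes "W d \<noteq> []" shows "t0 (hd (W d)) = lo d" "t0 (last (W d)) = hi d"
  using assms t0_nth[of 0 d] t0_nth[of "length (W d) - 1" d]
  by (simp_all add: hd_conv_nth last_conv_nth lo_def hi_def)

lemma t0_realizes: "realizes W t0"
  unfolding realizes_def
proof (intro conjI allI ballI)
  show "sorted_wrt (\<lambda>k l. t0 k < t0 l) (W d)" for d
    by (auto simp: sorted_wrt_iff_nth_less t0_nth intro!: divide_strict_right_mono)
  show "0 < t0 l" "t0 l < 1" if "l \<in> set (W d)" for l d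
    using t0_bounds[OF that] lohi[OF W_E[OF that]] by auto
qed

lemma t0_between:
  assumes "lo d \<le> q" "q \<le> hi d" "W d \<noteq> []" "\<And>l. l \<in> set (W d) \<Longrightarrow> q \<noteq> t0 l"
  obtains a b where "adjacent (W d) a b" "t0 a < q" "q < t0 b"
proof -
  let ?m = "length (W d)"
  \<comment> \<open>The letter of index \<open>i\<close> stands at \<open>(i + 1) / (m + 1)\<close>,
    so the neighbours of \<open>q\<close> have the indices \<open>z - 1\<close> and
    \<open>z\<close>.\<close>
  define z where "z = nat \<lfloor>q * real (Suc ?m)\<rfloor>"
  have b: "1 \<le> q * real (Suc ?m)" "q * real (Suc ?m) \<le> real ?m"
    using assms(1-3) by (simp_all add: lo_def hi_def field_simps)
  have z: "real z \<le> q * real (Suc ?m)" "q * real (Suc ?m) < real z + 1" "1 \<le> z"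
    using b unfolding z_def by (simp_all add: le_nat_floor)
  have "z \<le> ?m" using z b by linarith
  then have n: "t0 (W d ! (z - 1)) = real z / real (Suc ?m)" "z - 1 < ?m" using t0_nth[of "z - 1" d] z by auto
  then have "q \<noteq> real z / real (Suc ?m)" using assms(4) nth_mem by metis
  then have lt: "real z / real (Suc ?m) < q" using z by (simp add: field_simps)
  then have "real z < q * real (Suc ?m)" by (simp add: field_simps)
  then have zm: "z < ?m" using b by linarith
  have "q < real (Suc z) / real (Suc ?m)" using z by (simp add: field_simps)
  then have "q < t0 (W d ! z)" using t0_nth[OF zm] by simp
  moreover have "W d = take (z - 1) (W d) @ W d ! (z - 1) # W d ! z # drop (Suc z) (W d)"
    using zm z(3) by (metis One_nat_def Suc_pred Cons_nth_drop_Suc append_take_drop_id le_simps(3) n(2))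
  then have "adjacent (W d) (W d ! (z - 1)) (W d ! z)" by (rule adjacentI)
  ultimately show thesis using that lt n by metis
qed

definition conf :: "'a \<Rightarrow> nat \<Rightarrow> 'a" where
  "conf y = (\<lambda>l\<in>{1..n}. if l = k then y else \<phi> (edge_at W l) (t0 l))"

lemma letter_notin_T:
  assumes "l \<in> set (W d)" shows "\<phi> d (t0 l) \<notin> T"
proof -
  have "\<phi> d (t0 l) \<in> \<phi> d ` {lo d..hi d}" using t0_bounds[OF assms] by (intro imageI) simp
  then show ?thesis using W_E[OF assms] unfolding T_def by blast
qed

text \<open>All resting labels lie in the removed stretches, so \<open>k\<close> may be at any point
  of \<open>T\<close>, vertices included.\<close>

lemma conf_continuous: "continuous_map (subtopology X T) (Conf n X) conf"
proof (rule continuous_map_Conf)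
  have m: "edge_at W l \<in> E - F" "l \<in> set (W (edge_at W l))" if "l \<in> {1..n}" "l \<noteq> k" for l
    using edge_at_mem[OF W, of l] that by auto
  have bd: "0 < t0 l \<and> t0 l < 1" if "l \<in> {1..n}" "l \<noteq> k" for l
    using m[OF that] t0_realizes unfolding realizes_def by blast
  show "continuous_map (subtopology X T) X (\<lambda>y. conf y l)" if "l \<in> {1..n}" for l
  proof (cases "l = k")
    case True
    then show ?thesis using k continuous_map_from_subtopology[OF continuous_map_id]
      by (simp add: conf_def id_def)
  next
    case False
    then have "\<phi> (edge_at W l) (t0 l) \<in> topspace X" using m[OF that False] bd[OF that False] by (intro \<phi>_in_X) auto
    then show ?thesis using that False by (simp add: conf_def)
  qed
  show "conf y i \<noteq> conf y j" if y: "y \<in> topspace (subtopology X T)" and ij: "i \<in> {1..n}" "j \<in> {1..n}" "i \<noteq> j" for y i j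
  proof -
    have yk: "y \<noteq> \<phi> (edge_at W l) (t0 l)" if "l \<in> {1..n}" "l \<noteq> k" for l
      using letter_notin_T[OF m(2)[OF that]] y by auto
    show ?thesis
    proof (cases "i = k \<or> j = k")
      case True
      then show ?thesis using yk[of i] yk[of j] ij by (auto simp: conf_def)
    next
      case False
      then have "\<phi> (edge_at W i) (t0 i) = \<phi> (edge_at W j) (t0 j) \<longleftrightarrow> edge_at W i = edge_at W j \<and> t0 i = t0 j"
        using m[of i] m[of j] bd[of i] bd[of j] ij by (intro \<phi>_eq) auto
      moreover have "\<not> (edge_at W i = edge_at W j \<and> t0 i = t0 j)"
        using realizes_inj[OF t0_realizes, of i "edge_at W i" j] m[of i] m[of j] ij False by auto
      ultimately show ?thesis using ij False by (simp add: conf_def)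
    qed
  qed
qed (simp add: conf_def)

definition g :: "'a \<Rightarrow> 'a" where
  "g y = f (conf y)"

lemma g_continuous: "continuous_map (subtopology X T) X g"
  using continuous_map_compose[OF conf_continuous f_cont] by (simp add: g_def[abs_def] comp_def)

lemma conf_in: "y \<in> T \<Longrightarrow> conf y \<in> topspace (Conf n X)"
  using conf_continuous T_X by (auto simp: continuous_map_def Pi_iff)

lemma g_free: "y \<in> T \<Longrightarrow> g y \<noteq> y"
  using f_avoid[OF conf_in k] k by (simp add: g_def conf_def)

lemma g_avoid: "y \<in> T \<Longrightarrow> l \<in> set (W d) \<Longrightarrow> g y \<noteq> \<phi> d (t0 l)"
  using f_avoid[OF conf_in, of y l] W_letter[of l d] edge_at_eq[OF W, of l d] by (simp add: g_def conf_def)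

text \<open>\<open>k\<close> waits halfway along the stub \<open>h\<close>; this representative
  position makes the arrangement \<open>attach h k W\<close> a member of the family
  \<open>conf\<close>.\<close>

definition end_pos :: "'a set \<times> bool \<Rightarrow> nat \<Rightarrow> real" where
  "end_pos h = t0(k := if snd h then 1 - reach h / 2 else reach h / 2)"

lemma end_pos_letter: "l \<in> set (W d) \<Longrightarrow> end_pos h l = t0 l"
  using W_letter[of l d] by (simp add: end_pos_def)

lemma end_pos_k: "\<phi> (fst h) (end_pos h k) = half h (reach h / 2)"
  by (simp add: end_pos_def half_def)

lemma end_pos_realizes:
  assumes h: "fst h \<in> E - F"
  shows "realizes (attach h k W) (end_pos h)"
proof -
  have R: "realizes W (end_pos h)"
    unfolding realizes_def sorted_wrt_iff_nth_less
  proof (intro conjI allI impI ballI)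
    fix d i j assume ij: "i < j" "j < length (W d)"
    then have "end_pos h (W d ! i) = t0 (W d ! i)" "end_pos h (W d ! j) = t0 (W d ! j)"
      by (simp_all add: end_pos_letter[of _ d])
    then show "end_pos h (W d ! i) < end_pos h (W d ! j)" using realizes_less[OF t0_realizes ij] by simp
  next
    fix d l assume "l \<in> set (W d)"
    then have "0 < t0 l" "t0 l < 1" "end_pos h l = t0 l"
      using t0_realizes end_pos_letter unfolding realizes_def by blast+
    then show "0 < end_pos h l" "end_pos h l < 1" by simp_all
  qed
  have l: "0 < lo (fst h)" "lo (fst h) \<le> hi (fst h)" "hi (fst h) < 1" using lohi[OF h] by auto
  have kk: "0 < end_pos h k" "end_pos h k < 1" "snd h \<Longrightarrow> hi (fst h) < end_pos h k"
    "\<not> snd h \<Longrightarrow> end_pos h k < lo (fst h)"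
    using h l by (auto simp: end_pos_def reach_def field_simps)
  have b: "lo (fst h) \<le> end_pos h l" "end_pos h l \<le> hi (fst h)" if "l \<in> set (W (fst h))" for l
    using t0_bounds[OF that] end_pos_letter[OF that] by simp_all
  have "sorted_wrt (\<lambda>k l. end_pos h k < end_pos h l) (attach h k W d)" for d
  proof -
    have "sorted_wrt (\<lambda>k l. end_pos h k < end_pos h l) (W d)" using R unfolding realizes_def by blast
    moreover have "end_pos h l < end_pos h k" if "l \<in> set (W (fst h))" "snd h" for l
      using b(2)[OF that(1)] kk(3)[OF that(2)] by simp
    moreover have "end_pos h k < end_pos h l" if "l \<in> set (W (fst h))" "\<not> snd h" for l
      using b(1)[OF that(1)] kk(4)[OF that(2)] by simp
    ultimately show ?thesis
      by (cases "d = fst h"; cases "snd h") (simp_all add: attach_def sorted_wrt_append)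
  qed
  moreover have "0 < end_pos h l \<and> end_pos h l < 1" if "l \<in> set (attach h k W d)" for l d
    using that R kk unfolding realizes_def attach_def by (auto split: if_splits)
  ultimately show ?thesis unfolding realizes_def by blast
qed

lemma attach_arrangement: "fst h \<in> E - F \<Longrightarrow> arrangement (E - F) {1..n} (attach h k W)"
  using arrangement_attach[OF W k] .

lemma place_end:
  assumes h: "fst h \<in> E - F"
  shows "place (attach h k W) (end_pos h) = conf (half h (reach h / 2))"
proof
  fix l
  note A = attach_arrangement[OF h]
  show "place (attach h k W) (end_pos h) l = conf (half h (reach h / 2)) l"
  proof (cases "l \<in> {1..n} \<and> l \<noteq> k")
    case True
    then have m: "l \<in> set (W (edge_at W l))" using edge_at_mem[OF W] by blast
    then have "l \<in> set (attach h k W (edge_at W l))" by (auto simp: attach_def)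
    then have "edge_at (attach h k W) l = edge_at W l" by (rule edge_at_eq[OF A])
    then show ?thesis using True end_pos_letter[OF m] by (simp add: place_def conf_def)
  next
    case False
    have "k \<in> set (attach h k W (fst h))" by (simp add: attach_def)
    then have "edge_at (attach h k W) k = fst h" by (rule edge_at_eq[OF A])
    then show ?thesis using False k end_pos_k[of h] by (cases "l = k") (auto simp add: place_def conf_def)
  qed
qed

lemma half_reach_T: "fst h \<in> E - F \<Longrightarrow> half h (reach h / 2) \<in> T"
  using half_T[of h "reach h / 2"] reach_bounds[of h] by auto

lemma Sel_attach_iff:
  assumes h: "fst h \<in> E - F" and e: "e \<in> E - F" and adj: "adjacent (attach h k W e) a b"
  shows "Sel (attach h k W) e a b \<longleftrightarrow> g (half h (reach h / 2)) \<in> \<phi> e ` {end_pos h a<..<end_pos h b}"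
proof -
  have "Sel (attach h k W) e a b \<longleftrightarrow> f (place (attach h k W) (end_pos h)) \<in> \<phi> e ` {end_pos h a<..<end_pos h b}"
    using Sel_realizes[OF _ end_pos_realizes[OF h]] end_pos_realizes[OF h] attach_arrangement[OF h] e adj
    unfolding Sel_def by blast
  then show ?thesis by (simp add: place_end[OF h] g_def)
qed

lemma Sel_inner_iff:
  assumes h: "fst h \<in> E - F" and e: "e \<in> E - F" and adj: "adjacent (W e) a b"
  shows "Sel (attach h k W) e a b \<longleftrightarrow> g (half h (reach h / 2)) \<in> \<phi> e ` {t0 a<..<t0 b}"
  using Sel_attach_iff[OF h e adjacent_attach[of W e a b h k, OF adj]] realizes_adjacent(4,5)[OF t0_realizes adj]
  by (simp add: end_pos_letter)

text \<open>Only \<open>k\<close> moves, so the walls are constant and the connected parameter space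
  is \<open>T\<close> itself.\<close>

lemma gap_constant:
  assumes e: "e \<in> E - F" and adj: "adjacent (W e) a b" and y: "y \<in> T" "z \<in> T"
    and gap: "g y \<in> \<phi> e ` {t0 a<..<t0 b}"
  shows "g z \<in> \<phi> e ` {t0 a<..<t0 b}"
proof (rule trapped_in_arc[OF T_connected g_continuous, of "\<lambda>_. t0 a" "\<lambda>_. t0 b" e y z])
  note r = realizes_adjacent[OF t0_realizes adj]
  show "0 < t0 a \<and> t0 a < t0 b \<and> t0 b < 1" using r by simp
  show "g z \<noteq> \<phi> e (t0 a) \<and> g z \<noteq> \<phi> e (t0 b)" if "z \<in> topspace (subtopology X T)" for z
    using g_avoid r that by simp
qed (use e y gap T_X in auto)

lemma Sel_move:
  assumes "adjacent (W e) a b" "fst h \<in> E - F" "fst h' \<in> E - F" "Sel (attach h k W) e a b"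
  shows "Sel (attach h' k W) e a b"
proof -
  have e: "e \<in> E - F" using assms(4) unfolding Sel_def by blast
  show ?thesis
    using assms gap_constant[OF e assms(1) half_reach_T half_reach_T] Sel_inner_iff[OF _ e assms(1)] by blast
qed

text \<open>The neighbour of \<open>k\<close> sits exactly where the stub ends, so seen from the
  vertex the gap is the outer half of the stub, at either end of the edge.\<close>

lemma end_gap:
  assumes h: "fst h \<in> E - F" and ne: "W (fst h) \<noteq> []"
  shows "\<phi> (fst h) ` {end_pos h (end_left h k W)<..<end_pos h (end_right h k W)} =
    half h ` {reach h / 2<..<reach h}"
proof (cases "snd h")
  case True
  have "end_pos h (last (W (fst h))) = hi (fst h)"
    using end_pos_letter[of "last (W (fst h))" "fst h"] t0_ends ne by simp
  moreover have "end_pos h k = 1 - reach h / 2" "reach h = 1 - hi (fst h)"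
    using True h by (simp_all add: end_pos_def reach_def)
  moreover have "(\<lambda>r. 1 - r) ` {x<..<y} = {1 - y<..<1 - x}" for x y :: real
  proof (intro set_eqI iffI)
    fix q assume "q \<in> {1 - y<..<1 - x}"
    then have "q = 1 - (1 - q)" "1 - q \<in> {x<..<y}" by auto
    then show "q \<in> (\<lambda>r. 1 - r) ` {x<..<y}" by (rule image_eqI)
  qed auto
  ultimately have "{end_pos h (end_left h k W)<..<end_pos h (end_right h k W)} =
      (\<lambda>r. 1 - r) ` {reach h / 2<..<reach h}"
    using True by (simp add: end_left_def end_right_def)
  then show ?thesis using True by (simp add: image_image half_def)
next
  case False
  have "end_pos h (hd (W (fst h))) = lo (fst h)"
    using end_pos_letter[of "hd (W (fst h))" "fst h"] t0_ends ne by simp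
  moreover have "reach h = lo (fst h)" using False h by (simp add: reach_def)
  ultimately have 1: "end_pos h (hd (W (fst h))) = reach h" by simp
  have 2: "end_pos h k = reach h / 2" using False by (simp add: end_pos_def)
  have "{end_pos h (end_left h k W)<..<end_pos h (end_right h k W)} = {reach h / 2<..<reach h}"
    using False by (simp add: end_left_def end_right_def 1 2)
  then show ?thesis using False by (simp add: half_def)
qed

lemma adjacent_end:
  assumes "W (fst h) \<noteq> []"
  shows "adjacent (attach h k W (fst h)) (end_left h k W) (end_right h k W)"
proof (cases "snd h")
  case True
  have "W (fst h) = butlast (W (fst h)) @ [last (W (fst h))]" using assms by simp
  then have "attach h k W (fst h) = butlast (W (fst h)) @ last (W (fst h)) # k # []"
    using True by (simp add: attach_def)
  from adjacentI[OF this] show ?thesis using True by (simp add: end_left_def end_right_def)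
next
  case False
  have "attach h k W (fst h) = [] @ k # hd (W (fst h)) # tl (W (fst h))"
    using assms False by (simp add: attach_def)
  from adjacentI[OF this] show ?thesis using False by (simp add: end_left_def end_right_def)
qed

text \<open>A value outside \<open>T\<close> lies in a stretch \<open>[lo d, hi d]\<close> but is no
  label, hence lies between two neighbours, and there it stays for every position of
  \<open>k\<close>. On an empty edge no label would stand at the removed point.\<close>

lemma g_into_T_or_gap:
  assumes ne: "\<forall>d\<in>E - F. W d \<noteq> []"
  shows "(\<forall>y\<in>T. g y \<in> T) \<or>
    (\<exists>e a b. e \<in> E - F \<and> adjacent (W e) a b \<and> (\<forall>y\<in>T. g y \<in> \<phi> e ` {t0 a<..<t0 b}))"
proof (cases "\<forall>y\<in>T. g y \<in> T")
  case False
  then obtain y where y: "y \<in> T" "g y \<notin> T" by blast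
  have "g y \<in> topspace X" using g_continuous y T_X by (auto simp: continuous_map_def Pi_iff)
  then obtain d q where d: "d \<in> E - F" and q: "lo d \<le> q" "q \<le> hi d" "g y = \<phi> d q"
    using y(2) unfolding T_def by auto
  have "q \<noteq> t0 l" if "l \<in> set (W d)" for l using g_avoid[OF y(1) that] q by auto
  then obtain a b where ab: "adjacent (W d) a b" "t0 a < q" "q < t0 b"
    using t0_between[of d q] q ne d by metis
  then have "g y \<in> \<phi> d ` {t0 a<..<t0 b}" using q by auto
  then have "\<forall>y\<in>T. g y \<in> \<phi> d ` {t0 a<..<t0 b}"
    using gap_constant[OF d ab(1) y(1)] by blast
  then show ?thesis using d ab(1) by blast
qed simp

lemma ex1_end:
  assumes ne: "\<forall>d\<in>E - F. W d \<noteq> []" and into: "\<forall>y\<in>T. g y \<in> T"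
  shows "\<exists>!h. fst h \<in> E - F \<and> Sel (attach h k W) (fst h) (end_left h k W) (end_right h k W)"
proof -
  have gT: "continuous_map (subtopology X T) (subtopology X T) g"
    using g_continuous into by (auto simp: continuous_map_in_subtopology)
  have "outward g h \<longleftrightarrow> Sel (attach h k W) (fst h) (end_left h k W) (end_right h k W)"
    if h: "fst h \<in> E - F" for h
  proof -
    have hne: "W (fst h) \<noteq> []" using ne h by blast
    have "0 < reach h" using reach_bounds h by blast
    then show ?thesis
      using outward_end_iff[OF gT g_free h, of "reach h / 2"] Sel_attach_iff[OF h h adjacent_end[OF hne]]
        end_gap[OF h hne] by simp
  qed
  then have "(fst h \<in> E - F \<and> outward g h) \<longleftrightarrow>
      (fst h \<in> E - F \<and> Sel (attach h k W) (fst h) (end_left h k W) (end_right h k W))" for h by blast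
  then show ?thesis using ex1_outward_end[OF gT g_free] by simp
qed

text \<open>If \<open>g\<close> were trapped between resting labels, that gap would have to be the
  selected one by \<open>Sel_unique\<close>, yet the selected gap has \<open>k\<close> as a wall. So
  \<open>g\<close> is a self-map of \<open>T\<close>, and the count of outward ends applies.\<close>

lemma Sel_end_unique:
  assumes ne: "\<forall>d\<in>E - F. W d \<noteq> []"
    and S: "Sel (attach h k W) (fst h) (end_left h k W) (end_right h k W)"
    and S': "Sel (attach h' k W) (fst h') (end_left h' k W) (end_right h' k W)"
  shows "h = h'"
proof -
  have h: "fst h \<in> E - F" "fst h' \<in> E - F" using S S' unfolding Sel_def by blast+
  have "\<forall>y\<in>T. g y \<in> T"
  proof (rule ccontr)
    assume "\<not> (\<forall>y\<in>T. g y \<in> T)"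
    then obtain e a b where eab: "e \<in> E - F" "adjacent (W e) a b" "\<forall>y\<in>T. g y \<in> \<phi> e ` {t0 a<..<t0 b}"
      using g_into_T_or_gap[OF ne] by blast
    then have "Sel (attach h k W) e a b" using Sel_inner_iff[OF h(1)] half_reach_T[OF h(1)] by blast
    then have "a = end_left h k W" "b = end_right h k W" using Sel_unique[OF _ S] by blast+
    then have "a = k \<or> b = k" by (auto simp: end_left_def end_right_def split: if_splits)
    moreover have "a \<in> set (W e)" "b \<in> set (W e)" using realizes_adjacent[OF t0_realizes eab(2)] by blast+
    ultimately show False using W_letter by blast
  qed
  then show ?thesis using ex1_end[OF ne] S S' h by blast
qed

lemma Sel_exists:
  assumes ne: "\<forall>d\<in>E - F. W d \<noteq> []" and D: "E - F \<noteq> {}"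
  shows "\<exists>h e a b. fst h \<in> E - F \<and> Sel (attach h k W) e a b"
  using g_into_T_or_gap[OF ne]
proof
  assume "\<forall>y\<in>T. g y \<in> T"
  then show ?thesis using ex1_end[OF ne] by blast
next
  assume "\<exists>e a b. e \<in> E - F \<and> adjacent (W e) a b \<and> (\<forall>y\<in>T. g y \<in> \<phi> e ` {t0 a<..<t0 b})"
  then obtain e a b where eab: "e \<in> E - F" "adjacent (W e) a b" "\<forall>y\<in>T. g y \<in> \<phi> e ` {t0 a<..<t0 b}" by blast
  \<comment> \<open>A gap between resting labels traps \<open>f\<close> wherever \<open>k\<close>
    is, so any half-edge will do.\<close>
  have h: "fst (e, True) \<in> E - F" using eab by simp
  then have "Sel (attach (e, True) k W) e a b" using Sel_inner_iff[OF h eab(1,2)] half_reach_T[OF h] eab(3) by blast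
  then show ?thesis using h by blast
qed

end

context section_graph
begin

lemma no_section:
  assumes "2 \<le> card (E - F)" "card (E - F) + 1 \<le> n"
  shows False
proof -
  have mv: "mover X V E \<phi> F side n f k W"
    if "arrangement (E - F) ({1..n} - {k}) W" "k \<in> {1..n}" for k W
    using that section_graph_axioms by (intro mover.intro mover_axioms.intro)
  interpret gap_selection "E - F" "{1..n}" Sel
  proof
    show "finite (E - F)" using finite_E by blast
    show "finite {1..n}" "2 \<le> card (E - F)" "card (E - F) + 1 \<le> card {1..n}" using assms by simp_all
    show "arrangement (E - F) {1..n} W \<and> e \<in> E - F \<and> adjacent (W e) a b" if "Sel W e a b" for W e a b
      using that unfolding Sel_def by blast
    show "e = e' \<and> a = a' \<and> b = b'" if "Sel W e a b" "Sel W e' a' b'" for W e a b e' a' b'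
      using Sel_unique[OF that] .
    show "Sel (attach h' k W) e a b"
      if "arrangement (E - F) ({1..n} - {k}) W" "k \<in> {1..n}" "adjacent (W e) a b"
        "fst h \<in> E - F" "fst h' \<in> E - F" "Sel (attach h k W) e a b" for k W e a b h h'
      using mover.Sel_move[OF mv[OF that(1,2)] that(3-6)] .
    show "h = h'"
      if "arrangement (E - F) ({1..n} - {k}) W" "k \<in> {1..n}" "\<forall>d\<in>E - F. W d \<noteq> []"
        "Sel (attach h k W) (fst h) (end_left h k W) (end_right h k W)"
        "Sel (attach h' k W) (fst h') (end_left h' k W) (end_right h' k W)" for k W h h'
      using mover.Sel_end_unique[OF mv[OF that(1,2)] that(3-5)] .
    show "\<exists>h e a b. fst h \<in> E - F \<and> Sel (attach h k W) e a b"
      if "arrangement (E - F) ({1..n} - {k}) W" "k \<in> {1..n}" "\<forall>d\<in>E - F. W d \<noteq> []" for k W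
    proof (rule mover.Sel_exists[OF mv[OF that(1,2)] that(3)])
      show "E - F \<noteq> {}" using assms(1) by (metis card.empty not_numeral_le_zero)
    qed
  qed
  show False by (rule gap_selection_False)
qed

end

section \<open>Graph complexes and the final count\<close>

lemma graph_complex_cell_graph:
  assumes "graph_complex X V E"
  obtains \<phi> where "cell_graph X V E \<phi>"
proof -
  have "\<forall>e\<in>E. \<exists>p. continuous_map (top_of_set {0..1}) X p \<and>
      homeomorphic_map (top_of_set {0<..<1}) (subtopology X e) p \<and> p 0 \<in> V \<and> p (1::real) \<in> V"
    using assms unfolding graph_complex_def open_edge_def by blast
  from bchoice[OF this] obtain \<phi> where \<phi>: "\<And>e. e \<in> E \<Longrightarrow> continuous_map (top_of_set {0..1}) X (\<phi> e) \<and>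
      homeomorphic_map (top_of_set {0<..<1}) (subtopology X e) (\<phi> e) \<and> \<phi> e 0 \<in> V \<and> \<phi> e (1::real) \<in> V" by blast
  have "bij_betw (\<phi> e) {0<..<1} e" if e: "e \<in> E" for e
  proof -
    have "homeomorphic_map (top_of_set {0<..<1}) (subtopology X e) (\<phi> e)" using \<phi>[OF e] by blast
    moreover have "topspace (subtopology X e) = e"
      using assms e unfolding graph_complex_def by (auto simp: Int_absorb1)
    ultimately show ?thesis
      using homeomorphic_imp_surjective_map homeomorphic_imp_injective_map unfolding bij_betw_def by fastforce
  qed
  then have "cell_graph X V E \<phi>"
  proof unfold_locales
    show "Hausdorff_space X" "connected_space X" "finite V" "finite E" "topspace X = V \<union> \<Union>E"
      "V \<inter> \<Union>E = {}" "pairwise disjnt E"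
      using assms unfolding graph_complex_def by simp_all
    show "continuous_map (top_of_set {0..1}) X (\<phi> e)" "\<phi> e 0 \<in> V" "\<phi> e 1 \<in> V" if "e \<in> E" for e
      using \<phi>[OF that] by simp_all
  qed
  then show thesis by (rule that)
qed

theorem theorem1p1:
  fixes G :: "'a topology" and V :: "'a set" and E :: "'a set set" and n :: nat
  assumes "graph_complex G V E"
    and "euler_characteristic V E < 0"
    and "int n \<ge> 2 - euler_characteristic V E"
  shows "\<not> (\<exists>s. continuous_map (Conf n G) (Conf (n + 1) G) s \<and>
               (\<forall>x\<in>topspace (Conf n G). forget_last n (s x) = x))"
proof
  assume "\<exists>s. continuous_map (Conf n G) (Conf (n + 1) G) s \<and>
               (\<forall>x\<in>topspace (Conf n G). forget_last n (s x) = x)"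
  then obtain s where s: "continuous_map (Conf n G) (Conf (n + 1) G) s"
    and fs: "\<And>x. x \<in> topspace (Conf n G) \<Longrightarrow> forget_last n (s x) = x" by blast
  obtain \<phi> where "cell_graph G V E \<phi>" using graph_complex_cell_graph[OF assms(1)] .
  then interpret cell_graph G V E \<phi> .
  have "E \<noteq> {}" using assms(1) unfolding graph_complex_def by blast
  then have "V \<noteq> {}" using \<phi>_ends by blast
  obtain F side where F: "F \<subseteq> E" "card F + 1 = card V"
    "\<And>A. A \<inter> V \<noteq> {} \<Longrightarrow> V - A \<noteq> {} \<Longrightarrow> \<exists>e\<in>F. crosses src tgt e A"
    "\<And>e. e \<in> F \<Longrightarrow> src e \<in> side e \<and> tgt e \<notin> side e"
    "\<And>e e'. e \<in> F \<Longrightarrow> e' \<in> F \<Longrightarrow> e' \<noteq> e \<Longrightarrow> \<not> crosses src tgt e' (side e)"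
    using spanning_tree[OF finite_V finite_E \<open>V \<noteq> {}\<close>, of src tgt] \<phi>_ends crossing_edge by blast
  have sC: "s x \<in> topspace (Conf (n + 1) G)" if "x \<in> topspace (Conf n G)" for x
    using s that by (auto simp: continuous_map_def Pi_iff)
  interpret section_graph G V E \<phi> F side n "\<lambda>x. s x (n + 1)"
  proof
    have "continuous_map (Conf (n + 1) G) G (\<lambda>y. y (n + 1))"
      unfolding Conf_def
      by (intro continuous_map_from_subtopology continuous_map_product_projection) simp
    from continuous_map_compose[OF s this]
    show "continuous_map (Conf n G) G (\<lambda>x. s x (n + 1))" by (simp add: comp_def)
    show "s x (n + 1) \<noteq> x i" if x: "x \<in> topspace (Conf n G)" and i: "i \<in> {1..n}" for x i
    proof -
      have "x i = s x i" using fs[OF x] i by (metis forget_last_def restrict_apply')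
      moreover have "s x (n + 1) \<noteq> s x i" using sC[OF x] i by (auto simp: Conf_def)
      ultimately show ?thesis by simp
    qed
  qed (use F in blast)+
  \<comment> \<open>By \<open>card F + 1 = card V\<close> the number of edges outside the tree is
    \<open>1 - euler_characteristic V E\<close>.\<close>
  have "card (E - F) = card E - card F" "card F \<le> card E"
    using F(1) finite_E by (simp_all add: card_Diff_subset finite_subset card_mono)
  then have "2 \<le> card (E - F)" "card (E - F) + 1 \<le> n"
    using F(2) assms(2,3) unfolding euler_characteristic_def by linarith+
  then show False by (rule no_section)
qed

end
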